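(* Let $T>0$, $u_0\in H^1(\mathbb{R}^d)$, and let $q\in L^\infty(\mathbb{R}^d)$ be non-negative. Consider the Cauchy problem $$u_t(t,x)-\Delta u(t,x)+q(x)u(t,x)=0,\quad(t,x)\in[0,T]\times\mathbb{R}^d,\qquad u(0,x)=u_0(x),$$ and let $u$ be its classical solution. Let $(u_\varepsilon)_\varepsilon$ be a very weak solution of this problem. Then, for any regularising families $(q_\varepsilon)_\varepsilon$ and $(u_{0,\varepsilon})_\varepsilon$ of $q$ and $u_0$, the net $(u_\varepsilon)_\varepsilon$ converges in $L^2$ as $\varepsilon\to0$ to the classical solution, i.e. $\Vert u_\varepsilon(t,\cdot)-u(t,\cdot)\Vert_{L^2}\to0$ as $\varepsilon\to 0$ for $t\in[0,T]$.
   Context: The classical solution is the unique solution $u\in C^1([0,T];L^2(\mathbb{R}^d))\cap C([0,T];H^1(\mathbb{R}^d))$ of the Cauchy problem. Regularising families: $q_\varepsilon=q\ast\psi_\varepsilon$, $u_{0,\varepsilon}=u_0\ast\psi_\varepsilon$, where $\psi\in C_0^\infty(\mathbb{R}^d)$, $\psi\ge0$, $\int\psi=1$ (Friedrichs mollifier), $\psi_\varepsilon(x)=\omega(\varepsilon)^{-d}\psi(x/\omega(\varepsilon))$ for $\varepsilon\in(0,1]$, and $\omega(\varepsilon)$ is a positive function with $\omega(\varepsilon)\to0$ as $\varepsilon\to0$. Moderateness: for a Banach space $X$, a net $(f_\varepsilon)_{\varepsilon\in(0,1]}$ in $X$ is $X$-moderate if there exist $N\in\mathbb{N}_0$, $c>0$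 with $\Vert f_\varepsilon\Vert_X\le c\,\omega(\varepsilon)^{-N}$ for all $\varepsilon$. Very weak solution: the net $(u_\varepsilon)_\varepsilon$ is a very weak solution if, for an $L^\infty$-moderate regularisation $(q_\varepsilon)_\varepsilon$ of $q$ with $q_\varepsilon\ge0$ and an $H^1$-moderate regularisation $(u_{0,\varepsilon})_\varepsilon$ of $u_0$, $u_\varepsilon$ solves $\partial_t u_\varepsilon-\Delta u_\varepsilon+q_\varepsilon u_\varepsilon=0$ with $u_\varepsilon(0,\cdot)=u_{0,\varepsilon}$ for all $\varepsilon\in(0,1]$, and $(u_\varepsilon)_\varepsilon$ is $C([0,T];H^1(\mathbb{R}^d))$-moderate. *)

theory Defs
  imports "HOL-Analysis.Analysis" "HOL-Probability.Essential_Supremum"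
begin

text \<open>
  \<open>\<real>\<^sup>d\<close> is an arbitrary type \<open>'a :: euclidean_space\<close> with \<open>d = DIM('a)\<close>. Solutions are
  complex-valued, potentials real-valued. Elements of the function spaces are Lebesgue
  measurable representatives, so identities between them are stated almost everywhere.
\<close>

section \<open>Test functions\<close>

definition partial :: "'a::euclidean_space \<Rightarrow> ('a \<Rightarrow> real) \<Rightarrow> 'a \<Rightarrow> real" where
  "partial b f = (\<lambda>x. frechet_derivative f (at x) b)"

text \<open>
  All iterated partial derivatives are (totally) differentiable everywhere, hence also
  continuous; this is \<open>C\<^sup>\<infinity>\<close>.
\<close>
definition smooth :: "('a::euclidean_space \<Rightarrow> real) \<Rightarrow> bool" where
  "smooth f \<longleftrightarrow> (\<forall>bs. set bs \<subseteq> Basis \<longrightarrow> (\<forall>x. foldr partial bs f differentiable (at x)))"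

definition test_function :: "('a::euclidean_space \<Rightarrow> real) \<Rightarrow> bool" where
  "test_function \<phi> \<longleftrightarrow> smooth \<phi> \<and> compact (closure {x. \<phi> x \<noteq> 0})"

definition laplacian :: "('a::euclidean_space \<Rightarrow> real) \<Rightarrow> 'a \<Rightarrow> real" where
  "laplacian \<phi> x = (\<Sum>b\<in>Basis. partial b (partial b \<phi>) x)"

section \<open>Function spaces on \<open>\<real>\<^sup>d\<close>\<close>

definition L2 :: "('a::euclidean_space \<Rightarrow> complex) set" where
  "L2 = {f \<in> borel_measurable lebesgue. integrable lebesgue (\<lambda>x. (norm (f x))\<^sup>2)}"

definition L2_norm :: "('a::euclidean_space \<Rightarrow> complex) \<Rightarrow> real" where
  "L2_norm f = sqrt (LINT x|lebesgue. (norm (f x))\<^sup>2)"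

definition Linf :: "('a::euclidean_space \<Rightarrow> real) set" where
  "Linf = {f \<in> borel_measurable lebesgue. esssup lebesgue (\<lambda>x. ereal \<bar>f x\<bar>) < \<infinity>}"

definition Linf_norm :: "('a::euclidean_space \<Rightarrow> real) \<Rightarrow> real" where
  "Linf_norm f = real_of_ereal (esssup lebesgue (\<lambda>x. ereal \<bar>f x\<bar>))"

text \<open>Distributional derivatives of \<open>L\<^sup>2\<close> functions that are again in \<open>L\<^sup>2\<close>.\<close>

definition has_weak_partial ::
  "'a::euclidean_space \<Rightarrow> ('a \<Rightarrow> complex) \<Rightarrow> ('a \<Rightarrow> complex) \<Rightarrow> bool" where
  "has_weak_partial b f g \<longleftrightarrow> f \<in> L2 \<and> g \<in> L2 \<and>
     (\<forall>\<phi>. test_function \<phi> \<longrightarrow>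
        (LINT x|lebesgue. partial b \<phi> x *\<^sub>R f x) = - (LINT x|lebesgue. \<phi> x *\<^sub>R g x))"

definition has_weak_laplacian ::
  "('a::euclidean_space \<Rightarrow> complex) \<Rightarrow> ('a \<Rightarrow> complex) \<Rightarrow> bool" where
  "has_weak_laplacian f g \<longleftrightarrow> f \<in> L2 \<and> g \<in> L2 \<and>
     (\<forall>\<phi>. test_function \<phi> \<longrightarrow>
        (LINT x|lebesgue. laplacian \<phi> x *\<^sub>R f x) = (LINT x|lebesgue. \<phi> x *\<^sub>R g x))"

text \<open>Determined up to a null set whenever a weak derivative exists.\<close>
definition weak_partial :: "'a::euclidean_space \<Rightarrow> ('a \<Rightarrow> complex) \<Rightarrow> 'a \<Rightarrow> complex" where
  "weak_partial b f = (SOME g. has_weak_partial b f g)"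

definition H1 :: "('a::euclidean_space \<Rightarrow> complex) set" where
  "H1 = {f \<in> L2. \<forall>b\<in>Basis. \<exists>g. has_weak_partial b f g}"

definition H1_norm :: "('a::euclidean_space \<Rightarrow> complex) \<Rightarrow> real" where
  "H1_norm f = sqrt ((L2_norm f)\<^sup>2 + (\<Sum>b\<in>Basis. (L2_norm (weak_partial b f))\<^sup>2))"

section \<open>Functions of time with values in a function space\<close>

definition C_into ::
  "real \<Rightarrow> ('a \<Rightarrow> complex) set \<Rightarrow> (('a \<Rightarrow> complex) \<Rightarrow> real) \<Rightarrow> (real \<Rightarrow> 'a \<Rightarrow> complex) set" where
  "C_into T X nrm = {u. \<forall>t\<in>{0..T}. u t \<in> X \<and>
     ((\<lambda>s. nrm (\<lambda>x. u s x - u t x)) \<longlongrightarrow> 0) (at t within {0..T})}"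

definition C_norm ::
  "real \<Rightarrow> (('a \<Rightarrow> complex) \<Rightarrow> real) \<Rightarrow> (real \<Rightarrow> 'a \<Rightarrow> complex) \<Rightarrow> real" where
  "C_norm T nrm u = (SUP t\<in>{0..T}. nrm (u t))"

text \<open>\<open>u \<in> C\<^sup>1([0,T]; L\<^sup>2)\<close> with derivative \<open>u'\<close>, one-sided at the end points.\<close>
definition has_C1_L2_deriv ::
  "real \<Rightarrow> (real \<Rightarrow> 'a::euclidean_space \<Rightarrow> complex) \<Rightarrow> (real \<Rightarrow> 'a \<Rightarrow> complex) \<Rightarrow> bool" where
  "has_C1_L2_deriv T u u' \<longleftrightarrow> u \<in> C_into T L2 L2_norm \<and> u' \<in> C_into T L2 L2_norm \<and>
     (\<forall>t\<in>{0..T}. ((\<lambda>s. L2_norm (\<lambda>x. (u s x - u t x) /\<^sub>R (s - t) - u' t x)) \<longlongrightarrow> 0)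
                    (at t within {0..T}))"

section \<open>The Cauchy problem\<close>

text \<open>
  For \<open>u \<in> C\<^sup>1([0,T]; L\<^sup>2) \<inter> C([0,T]; H\<^sup>1)\<close> the equation forces the distribution \<open>\<Delta>u(t)\<close> to be
  the \<open>L\<^sup>2\<close> function \<open>u\<^sub>t(t) + q u(t)\<close>, for every \<open>t\<close> in \<open>[0,T]\<close>.
\<close>
definition classical_solution ::
  "real \<Rightarrow> ('a::euclidean_space \<Rightarrow> real) \<Rightarrow> ('a \<Rightarrow> complex) \<Rightarrow> (real \<Rightarrow> 'a \<Rightarrow> complex) \<Rightarrow> bool" where
  "classical_solution T q u0 u \<longleftrightarrow>
     u \<in> C_into T H1 H1_norm \<and>
     (\<exists>u'. has_C1_L2_deriv T u u' \<and>
        (\<forall>t\<in>{0..T}. \<exists>Lu. has_weak_laplacian (u t) Lu \<and>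
           (AE x in lebesgue. u' t x - Lu x + q x *\<^sub>R u t x = 0))) \<and>
     (AE x in lebesgue. u 0 x = u0 x)"

section \<open>Regularisation and very weak solutions\<close>

definition friedrichs_mollifier :: "('a::euclidean_space \<Rightarrow> real) \<Rightarrow> bool" where
  "friedrichs_mollifier \<psi> \<longleftrightarrow>
     test_function \<psi> \<and> (\<forall>x. \<psi> x \<ge> 0) \<and> (LINT x|lebesgue. \<psi> x) = 1"

definition scaled :: "('a::euclidean_space \<Rightarrow> real) \<Rightarrow> real \<Rightarrow> 'a \<Rightarrow> real" where
  "scaled \<psi> r x = \<psi> (x /\<^sub>R r) / r ^ DIM('a)"

definition convolve ::
  "('a::euclidean_space \<Rightarrow> 'b::{banach, second_countable_topology}) \<Rightarrow> ('a \<Rightarrow> real) \<Rightarrow> 'a \<Rightarrow> 'b" where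
  "convolve f \<psi> x = (LINT y|lebesgue. \<psi> (x - y) *\<^sub>R f y)"

definition regularising_scale :: "(real \<Rightarrow> real) \<Rightarrow> bool" where
  "regularising_scale \<omega> \<longleftrightarrow> (\<forall>\<epsilon>\<in>{0<..1}. \<omega> \<epsilon> > 0) \<and> (\<omega> \<longlongrightarrow> 0) (at_right 0)"

definition regularising_families ::
  "(real \<Rightarrow> real) \<Rightarrow> ('a::euclidean_space \<Rightarrow> real) \<Rightarrow> ('a \<Rightarrow> complex) \<Rightarrow>
   (real \<Rightarrow> 'a \<Rightarrow> real) \<Rightarrow> (real \<Rightarrow> 'a \<Rightarrow> complex) \<Rightarrow> bool" where
  "regularising_families \<omega> q u0 q\<epsilon> u0\<epsilon> \<longleftrightarrow>
     (\<exists>\<psi>. friedrichs_mollifier \<psi> \<and>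
        (\<forall>\<epsilon>\<in>{0<..1}. q\<epsilon> \<epsilon> = convolve q (scaled \<psi> (\<omega> \<epsilon>)) \<and>
                        u0\<epsilon> \<epsilon> = convolve u0 (scaled \<psi> (\<omega> \<epsilon>))))"

definition moderate ::
  "(real \<Rightarrow> real) \<Rightarrow> 'x set \<Rightarrow> ('x \<Rightarrow> real) \<Rightarrow> (real \<Rightarrow> 'x) \<Rightarrow> bool" where
  "moderate \<omega> X nrm f \<longleftrightarrow> (\<forall>\<epsilon>\<in>{0<..1}. f \<epsilon> \<in> X) \<and>
     (\<exists>(N::nat) c. c > 0 \<and> (\<forall>\<epsilon>\<in>{0<..1}. nrm (f \<epsilon>) \<le> c / \<omega> \<epsilon> ^ N))"

text \<open>The net \<open>u\<epsilon>\<close> is a very weak solution, obtained from the families \<open>q\<epsilon>\<close> and \<open>u0\<epsilon>\<close>.\<close>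
definition very_weak_solution ::
  "real \<Rightarrow> (real \<Rightarrow> real) \<Rightarrow> ('a::euclidean_space \<Rightarrow> real) \<Rightarrow> ('a \<Rightarrow> complex) \<Rightarrow>
   (real \<Rightarrow> 'a \<Rightarrow> real) \<Rightarrow> (real \<Rightarrow> 'a \<Rightarrow> complex) \<Rightarrow> (real \<Rightarrow> real \<Rightarrow> 'a \<Rightarrow> complex) \<Rightarrow> bool" where
  "very_weak_solution T \<omega> q u0 q\<epsilon> u0\<epsilon> u\<epsilon> \<longleftrightarrow>
     regularising_families \<omega> q u0 q\<epsilon> u0\<epsilon> \<and>
     moderate \<omega> Linf Linf_norm q\<epsilon> \<and>
     (\<forall>\<epsilon>\<in>{0<..1}. AE x in lebesgue. q\<epsilon> \<epsilon> x \<ge> 0) \<and>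
     moderate \<omega> H1 H1_norm u0\<epsilon> \<and>
     (\<forall>\<epsilon>\<in>{0<..1}. classical_solution T (q\<epsilon> \<epsilon>) (u0\<epsilon> \<epsilon>) (u\<epsilon> \<epsilon>)) \<and>
     moderate \<omega> (C_into T H1 H1_norm) (C_norm T H1_norm) u\<epsilon>"

end

theory Submission
  imports Defs "HOL-Probability.Probability_Measure"
begin

text \<open>
  The difference \<open>v = u\<^sub>\<epsilon> - u\<close> solves \<open>v\<^sub>t - \<Delta>v + q\<^sub>\<epsilon> v = -(q\<^sub>\<epsilon> - q) u\<close>. Testing with \<open>v\<close> and using
  \<open>\<langle>v, \<Delta>v\<rangle> \<le> 0\<close> and \<open>q\<^sub>\<epsilon> \<ge> 0\<close> gives \<open>d/dt \<parallel>v\<parallel>\<^sup>2 \<le> 2 \<delta> \<parallel>v\<parallel>\<close>, where \<open>\<delta>\<close> bounds \<open>\<parallel>(q\<^sub>\<epsilon> - q) u(s)\<parallel>\<close> on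
  \<open>[0,T]\<close>; hence \<open>\<parallel>v(t)\<parallel> \<le> \<parallel>v(0)\<parallel> + \<delta> t\<close>.

  Both \<open>\<parallel>v(0)\<parallel>\<close> and \<open>\<delta>\<close> vanish in the limit by continuity of translations in \<open>L\<^sup>2\<close>: by Jensen's
  inequality it suffices to control \<open>f(\<cdot> - h) - f\<close>, respectively
  \<open>(q(\<cdot> - h) - q) u = (q u)(\<cdot> - h) - q u - q(\<cdot> - h) (u(\<cdot> - h) - u)\<close>, for small \<open>h\<close>.
  Uniformity in \<open>s\<close> follows since the maps \<open>s \<mapsto> \<parallel>(q\<^sub>\<epsilon> - q) u(s)\<parallel>\<close> are equicontinuous on \<open>[0,T]\<close>.
\<close>

section \<open>Complete measures\<close>

context complete_measure
begin

lemma borel_measurable_cong_AE: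
  fixes f g :: "'a \<Rightarrow> 'b::topological_space"
  assumes "AE x in M. f x = g x"
  shows "f \<in> borel_measurable M \<longleftrightarrow> g \<in> borel_measurable M"
proof -
  have "g \<in> borel_measurable M"
    if f: "f \<in> borel_measurable M" and eq: "AE x in M. f x = g x"
    for f g :: "'a \<Rightarrow> 'b"
  proof (rule measurableI)
    fix A :: "'b set" assume "A \<in> sets borel"
    have "AE x in M. x \<in> f -` A \<inter> space M \<longleftrightarrow> x \<in> g -` A \<inter> space M"
      using eq by eventually_elim simp
    then show "g -` A \<inter> space M \<in> sets M"
      by (rule in_sets_AE) (use f \<open>A \<in> sets borel\<close> in \<open>auto intro: measurable_sets\<close>)
  qed simp
  moreover have "AE x in M. g x = f x" using assms by eventually_elim simp
  ultimately show ?thesis using assms by blast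
qed

lemma integrable_cong_AE:
  fixes f g :: "'a \<Rightarrow> 'b::{banach, second_countable_topology}"
  assumes "AE x in M. f x = g x"
  shows "integrable M f \<longleftrightarrow> integrable M g"
  using borel_measurable_cong_AE[OF assms] Bochner_Integration.integrable_cong_AE[OF _ _ assms]
    borel_measurable_integrable by blast

lemma integral_cong_AE:
  fixes f g :: "'a \<Rightarrow> 'b::{banach, second_countable_topology}"
  assumes "AE x in M. f x = g x"
  shows "integral\<^sup>L M f = integral\<^sup>L M g"
proof (cases "f \<in> borel_measurable M")
  case True
  with assms show ?thesis
    by (intro Bochner_Integration.integral_cong_AE) (simp_all add: borel_measurable_cong_AE)
next
  case False
  with borel_measurable_cong_AE[OF assms] show ?thesis
    using borel_measurable_integrable not_integrable_integral_eq by metis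
qed

end

section \<open>Lebesgue measurable functions\<close>

lemma borel_measurable_lebesgue_if_borel:
  "f \<in> borel_measurable borel \<Longrightarrow> f \<in> borel_measurable lebesgue"
  by (rule measurable_completion) simp

lemma ex_borel_version:
  fixes f :: "'a::euclidean_space \<Rightarrow> 'b::euclidean_space"
  assumes f: "f \<in> borel_measurable lebesgue"
  obtains g where "g \<in> borel_measurable borel" "AE x in lebesgue. f x = g x"
proof -
  have "\<exists>h. h \<in> borel_measurable lborel \<and> (AE x in lborel. f x \<bullet> b = h x)" for b
    using f completion_ex_borel_measurable_real[of "\<lambda>x. f x \<bullet> b" lborel] by auto
  then obtain h where h: "\<And>b. h b \<in> borel_measurable lborel" "\<And>b. AE x in lborel. f x \<bullet> b = h b x"
    by metis
  show thesis
  proof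
    show "(\<lambda>x. \<Sum>b\<in>Basis. h b x *\<^sub>R b) \<in> borel_measurable borel"
      using h(1) by (intro borel_measurable_sum borel_measurable_scaleR) simp_all
    have "AE x in lebesgue. \<forall>b\<in>Basis. f x \<bullet> b = h b x"
      by (rule AE_finite_allI) (auto intro: AE_completion h(2))
    then show "AE x in lebesgue. f x = (\<Sum>b\<in>Basis. h b x *\<^sub>R b)"
    proof eventually_elim
      case (elim x)
      then show ?case using euclidean_representation[of "f x"] by simp
    qed
  qed
qed

lemma
  fixes t :: "'a::euclidean_space"
  assumes "c \<noteq> 0"
  shows lebesgue_affine:
      "lebesgue = density (distr lebesgue lebesgue (\<lambda>x. t + c *\<^sub>R x)) (\<lambda>_. \<bar>c\<bar> ^ DIM('a))"
    and measurable_lebesgue_affine: "(\<lambda>x. t + c *\<^sub>R x) \<in> lebesgue \<rightarrow>\<^sub>M lebesgue"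
proof -
  have "(\<lambda>x. t + (\<Sum>j\<in>Basis. (c * (x \<bullet> j)) *\<^sub>R j)) = (\<lambda>x. t + c *\<^sub>R x)"
    unfolding scaleR_scaleR[symmetric] scaleR_sum_right[symmetric] euclidean_representation ..
  then show "lebesgue = density (distr lebesgue lebesgue (\<lambda>x. t + c *\<^sub>R x)) (\<lambda>_. \<bar>c\<bar> ^ DIM('a))"
    "(\<lambda>x. t + c *\<^sub>R x) \<in> lebesgue \<rightarrow>\<^sub>M lebesgue"
    using lebesgue_affine_euclidean[of "\<lambda>_. c" t] lebesgue_affine_measurable[of "\<lambda>_. c" t] assms
    by simp_all
qed

lemma AE_lebesgue_affine:
  fixes t :: "'a::euclidean_space"
  assumes "AE x in lebesgue. P x" "c \<noteq> 0"
  shows "AE x in lebesgue. P (t + c *\<^sub>R x)"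
proof -
  note [measurable] = measurable_lebesgue_affine[OF \<open>c \<noteq> 0\<close>, of t]
  have "AE x in density (distr lebesgue lebesgue (\<lambda>x. t + c *\<^sub>R x)) (\<lambda>_. \<bar>c\<bar> ^ DIM('a)). P x"
    using assms(1) unfolding lebesgue_affine[OF \<open>c \<noteq> 0\<close>, of t, symmetric] .
  then have "AE x in distr lebesgue lebesgue (\<lambda>x. t + c *\<^sub>R x). P x"
    using \<open>c \<noteq> 0\<close> by (simp add: AE_density)
  then show ?thesis by (rule AE_distrD[rotated]) measurable
qed

lemma borel_measurable_lebesgue_affine_iff:
  fixes t :: "'a::euclidean_space"
  assumes "c \<noteq> 0"
  shows "(\<lambda>x. f (t + c *\<^sub>R x)) \<in> borel_measurable lebesgue \<longleftrightarrow> f \<in> borel_measurable lebesgue"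
proof
  assume "(\<lambda>x. f (t + c *\<^sub>R x)) \<in> borel_measurable lebesgue"
  from measurable_compose[OF measurable_lebesgue_affine this, of "1 / c" "- (1 / c) *\<^sub>R t"]
  show "f \<in> borel_measurable lebesgue" using assms by (simp add: scaleR_diff_right)
qed (rule measurable_compose[OF measurable_lebesgue_affine[OF assms]])

lemma
  fixes f :: "'a::euclidean_space \<Rightarrow> 'b::{banach, second_countable_topology}"
  assumes "c \<noteq> 0"
  shows integrable_lebesgue_affine_iff:
      "integrable lebesgue (\<lambda>x. f (t + c *\<^sub>R x)) \<longleftrightarrow> integrable lebesgue f"
    and integral_lebesgue_affine:
      "(LINT x|lebesgue. f x) = \<bar>c\<bar> ^ DIM('a) *\<^sub>R (LINT x|lebesgue. f (t + c *\<^sub>R x))"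
proof -
  note [measurable] = measurable_lebesgue_affine[OF assms, of t]
  have [simp]: "\<not> integrable lebesgue f" "\<not> integrable lebesgue (\<lambda>x. f (t + c *\<^sub>R x))"
    if "f \<notin> borel_measurable lebesgue"
    using that borel_measurable_lebesgue_affine_iff[OF assms, of f t]
    by (auto dest: borel_measurable_integrable)
  show "integrable lebesgue (\<lambda>x. f (t + c *\<^sub>R x)) \<longleftrightarrow> integrable lebesgue f"
  proof (cases "f \<in> borel_measurable lebesgue")
    case [measurable]: True
    have "integrable lebesgue f \<longleftrightarrow> integrable lebesgue (\<lambda>x. \<bar>c\<bar> ^ DIM('a) *\<^sub>R f (t + c *\<^sub>R x))"
      by (subst lebesgue_affine[OF assms, of t]) (simp add: integrable_density integrable_distr_eq)
    also have "\<dots> \<longleftrightarrow> integrable lebesgue (\<lambda>x. f (t + c *\<^sub>R x))"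
      using assms integrable_scaleR_right[of "1 / \<bar>c\<bar> ^ DIM('a)" lebesgue
          "\<lambda>x. \<bar>c\<bar> ^ DIM('a) *\<^sub>R f (t + c *\<^sub>R x)"] by auto
    finally show ?thesis ..
  qed simp
  show "(LINT x|lebesgue. f x) = \<bar>c\<bar> ^ DIM('a) *\<^sub>R (LINT x|lebesgue. f (t + c *\<^sub>R x))"
  proof (cases "f \<in> borel_measurable lebesgue")
    case [measurable]: True
    show ?thesis
      by (subst lebesgue_affine[OF assms, of t]) (simp add: integral_density integral_distr)
  qed (simp add: not_integrable_integral_eq)
qed

lemma AE_lebesgue_translate: "AE x in lebesgue. P x \<Longrightarrow> AE x in lebesgue. P (x - h)"
  for h :: "'a::euclidean_space"
  using AE_lebesgue_affine[of P 1 "- h"] by simp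

lemma AE_lebesgue_reflect: "AE x in lebesgue. P x \<Longrightarrow> AE x in lebesgue. P (a - x)"
  for a :: "'a::euclidean_space"
  using AE_lebesgue_affine[of P "-1" a] by simp

lemma
  fixes f :: "'a::euclidean_space \<Rightarrow> 'b::{banach, second_countable_topology}"
  shows integrable_lebesgue_translate_iff:
      "integrable lebesgue (\<lambda>x. f (x - h)) \<longleftrightarrow> integrable lebesgue f"
    and integral_lebesgue_translate: "(LINT x|lebesgue. f (x - h)) = (LINT x|lebesgue. f x)"
  using integrable_lebesgue_affine_iff[of 1 f "- h"] integral_lebesgue_affine[of 1 f "- h"]
  by simp_all

section \<open>The function spaces \<open>L\<^sup>2\<close> and \<open>L\<^sup>\<infinity>\<close>\<close>

lemma
  fixes f :: "'a \<Rightarrow> 'b::{banach, second_countable_topology}"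
    and g :: "'a \<Rightarrow> 'c::{banach, second_countable_topology}"
  assumes [measurable]: "f \<in> borel_measurable M" "g \<in> borel_measurable M"
    and f: "integrable M (\<lambda>x. (norm (f x))\<^sup>2)" and g: "integrable M (\<lambda>x. (norm (g x))\<^sup>2)"
  shows integrable_norm_mult: "integrable M (\<lambda>x. norm (f x) * norm (g x))"
    and Cauchy_Schwarz_integral: "(LINT x|M. norm (f x) * norm (g x)) \<le>
      sqrt (LINT x|M. (norm (f x))\<^sup>2) * sqrt (LINT x|M. (norm (g x))\<^sup>2)"
proof -
  let ?F = "LINT x|M. (norm (f x))\<^sup>2" and ?G = "LINT x|M. (norm (g x))\<^sup>2"
  have square_le: "(\<integral>\<^sup>+x. ennreal (norm (f x) * norm (g x)) \<partial>M)\<^sup>2 \<le> ennreal (?F * ?G)"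
    using Cauchy_Schwarz_nn_integral[of "\<lambda>x. ennreal (norm (f x))" M "\<lambda>x. ennreal (norm (g x))"]
    by (simp add: ennreal_mult ennreal_power nn_integral_eq_integral f g)
  then have "(\<integral>\<^sup>+x. ennreal (norm (f x) * norm (g x)) \<partial>M) < \<infinity>"
    using le_less_trans[OF square_le ennreal_less_top] by (simp add: power_less_top_ennreal)
  then show int: "integrable M (\<lambda>x. norm (f x) * norm (g x))"
    by (intro integrableI_bounded) auto
  have "(LINT x|M. norm (f x) * norm (g x))\<^sup>2 \<le> ?F * ?G"
    using square_le by (simp add: nn_integral_eq_integral[OF int] ennreal_power)
  then show "(LINT x|M. norm (f x) * norm (g x)) \<le> sqrt ?F * sqrt ?G"
    using real_le_rsqrt by (simp flip: real_sqrt_mult)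
qed

definition L2_inner :: "('a::euclidean_space \<Rightarrow> complex) \<Rightarrow> ('a \<Rightarrow> complex) \<Rightarrow> real" where
  "L2_inner f g = (LINT x|lebesgue. f x \<bullet> g x)"

lemma L2_measurable [measurable_dest]: "f \<in> L2 \<Longrightarrow> f \<in> borel_measurable lebesgue"
  by (simp add: L2_def)

lemma L2_square_integrable: "f \<in> L2 \<Longrightarrow> integrable lebesgue (\<lambda>x. (norm (f x))\<^sup>2)"
  by (simp add: L2_def)

lemma L2_norm_nonneg [simp]: "0 \<le> L2_norm f"
  by (simp add: L2_norm_def)

lemma L2_norm_square: "(L2_norm f)\<^sup>2 = L2_inner f f"
  by (simp add: L2_norm_def L2_inner_def dot_square_norm)

lemma L2_norm_minus_commute: "L2_norm (\<lambda>x. f x - g x) = L2_norm (\<lambda>x. g x - f x)"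
  by (simp add: L2_norm_def norm_minus_commute)

lemma L2_cong_AE:
  assumes "AE x in lebesgue. f x = g x"
  shows "f \<in> L2 \<longleftrightarrow> g \<in> L2"
proof -
  have "AE x in lebesgue. (norm (f x))\<^sup>2 = (norm (g x))\<^sup>2"
    using assms by eventually_elim simp
  from completion.integrable_cong_AE[OF this] completion.borel_measurable_cong_AE[OF assms]
  show ?thesis by (simp add: L2_def)
qed

lemma L2_inner_cong_AE:
  assumes "AE x in lebesgue. f x = f' x" "AE x in lebesgue. g x = g' x"
  shows "L2_inner f g = L2_inner f' g'"
  unfolding L2_inner_def
proof (rule completion.integral_cong_AE)
  show "AE x in lebesgue. f x \<bullet> g x = f' x \<bullet> g' x"
    using assms by eventually_elim simp
qed

lemma L2_norm_cong_AE: "AE x in lebesgue. f x = g x \<Longrightarrow> L2_norm f = L2_norm g"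
  using L2_inner_cong_AE[of f g f g] power2_eq_imp_eq[of "L2_norm f" "L2_norm g"]
  by (simp add: L2_norm_square)

lemma L2_inner_integrable:
  assumes "f \<in> L2" "g \<in> L2"
  shows "integrable lebesgue (\<lambda>x. f x \<bullet> g x)"
proof (rule Bochner_Integration.integrable_bound)
  show "integrable lebesgue (\<lambda>x. norm (f x) * norm (g x))"
    using assms by (intro integrable_norm_mult L2_measurable L2_square_integrable)
  show "AE x in lebesgue. norm (f x \<bullet> g x) \<le> norm (norm (f x) * norm (g x))"
    by (simp add: Cauchy_Schwarz_ineq2)
qed (use assms in measurable)

lemma L2_integral_abs_inner_le:
  assumes "f \<in> L2" "g \<in> L2"
  shows "(LINT x|lebesgue. \<bar>f x \<bullet> g x\<bar>) \<le> L2_norm f * L2_norm g"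
proof -
  have "(LINT x|lebesgue. \<bar>f x \<bullet> g x\<bar>) \<le> (LINT x|lebesgue. norm (f x) * norm (g x))"
    using assms by (intro integral_mono integrable_abs L2_inner_integrable integrable_norm_mult
        L2_measurable L2_square_integrable Cauchy_Schwarz_ineq2)
  also have "\<dots> \<le> L2_norm f * L2_norm g"
    unfolding L2_norm_def using assms
    by (intro Cauchy_Schwarz_integral L2_measurable L2_square_integrable)
  finally show ?thesis .
qed

lemma L2_inner_bound: "f \<in> L2 \<Longrightarrow> g \<in> L2 \<Longrightarrow> \<bar>L2_inner f g\<bar> \<le> L2_norm f * L2_norm g"
  unfolding L2_inner_def by (rule order_trans[OF integral_abs_bound L2_integral_abs_inner_le])

lemma L2_scaleR: "f \<in> L2 \<Longrightarrow> (\<lambda>x. c *\<^sub>R f x) \<in> L2"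
  by (auto simp: L2_def power_mult_distrib)

lemma L2_add:
  assumes "f \<in> L2" "g \<in> L2"
  shows "(\<lambda>x. f x + g x) \<in> L2"
proof -
  note [measurable] = assms[THEN L2_measurable]
  have "integrable lebesgue (\<lambda>x. (norm (f x))\<^sup>2 + 2 * (f x \<bullet> g x) + (norm (g x))\<^sup>2)"
    using assms L2_inner_integrable[OF assms] by (auto simp: L2_def)
  then show ?thesis
    by (simp add: L2_def power2_norm_eq_inner inner_add inner_commute algebra_simps)
qed

lemma L2_diff: "f \<in> L2 \<Longrightarrow> g \<in> L2 \<Longrightarrow> (\<lambda>x. f x - g x) \<in> L2"
  using L2_add[of f "\<lambda>x. (-1) *\<^sub>R g x"] L2_scaleR[of g "-1"] by simp

lemma L2_inner_add_right:
  "f \<in> L2 \<Longrightarrow> g \<in> L2 \<Longrightarrow> h \<in> L2 \<Longrightarrow> L2_inner f (\<lambda>x. g x + h x) = L2_inner f g + L2_inner f h"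
  by (simp add: L2_inner_def inner_add_right L2_inner_integrable)

lemma L2_inner_diff_right:
  "f \<in> L2 \<Longrightarrow> g \<in> L2 \<Longrightarrow> h \<in> L2 \<Longrightarrow> L2_inner f (\<lambda>x. g x - h x) = L2_inner f g - L2_inner f h"
  by (simp add: L2_inner_def inner_diff_right L2_inner_integrable)

lemma L2_inner_scaleR_right: "L2_inner f (\<lambda>x. c *\<^sub>R g x) = c * L2_inner f g"
  by (simp add: L2_inner_def)

lemma L2_inner_commute: "L2_inner f g = L2_inner g f"
  by (simp add: L2_inner_def inner_commute)

lemma L2_norm_scaleR: "L2_norm (\<lambda>x. c *\<^sub>R f x) = \<bar>c\<bar> * L2_norm f"
  by (simp add: L2_norm_def power_mult_distrib real_sqrt_mult)

lemma L2_norm_add_square: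
  assumes "f \<in> L2" "g \<in> L2"
  shows "(L2_norm (\<lambda>x. f x + g x))\<^sup>2 = (L2_norm f)\<^sup>2 + 2 * L2_inner f g + (L2_norm g)\<^sup>2"
proof -
  have "(LINT x|lebesgue. (f x + g x) \<bullet> (f x + g x)) =
      (LINT x|lebesgue. f x \<bullet> f x + 2 * (f x \<bullet> g x) + g x \<bullet> g x)"
    by (simp add: inner_add inner_commute algebra_simps)
  then show ?thesis
    using assms by (simp add: L2_norm_square L2_inner_def L2_inner_integrable)
qed

lemma L2_norm_triangle:
  assumes "f \<in> L2" "g \<in> L2"
  shows "L2_norm (\<lambda>x. f x + g x) \<le> L2_norm f + L2_norm g"
proof (rule power2_le_imp_le)
  show "(L2_norm (\<lambda>x. f x + g x))\<^sup>2 \<le> (L2_norm f + L2_norm g)\<^sup>2"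
    using L2_inner_bound[OF assms] by (simp add: L2_norm_add_square[OF assms] power2_sum)
qed simp

lemma L2_norm_diff_le:
  assumes "f \<in> L2" "g \<in> L2"
  shows "L2_norm (\<lambda>x. f x - g x) \<le> L2_norm f + L2_norm g"
  using L2_norm_triangle[OF assms(1) L2_scaleR[OF assms(2)], of "-1"] by (simp add: L2_norm_def)

lemma L2_norm_triangle_diff:
  assumes "f \<in> L2" "g \<in> L2"
  shows "\<bar>L2_norm f - L2_norm g\<bar> \<le> L2_norm (\<lambda>x. f x - g x)"
  using L2_norm_triangle[OF L2_diff[OF assms] assms(2)]
    L2_norm_triangle[OF L2_diff[OF assms(2,1)] assms(1)]
  by (simp add: L2_norm_minus_commute[of g f])

lemma L2_inner_tendsto:
  assumes fn: "\<forall>\<^sub>F n in F. fn n \<in> L2" and gn: "\<forall>\<^sub>F n in F. gn n \<in> L2"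
    and f: "f \<in> L2" and g: "g \<in> L2"
    and limf: "((\<lambda>n. L2_norm (\<lambda>x. fn n x - f x)) \<longlongrightarrow> 0) F"
    and limg: "((\<lambda>n. L2_norm (\<lambda>x. gn n x - g x)) \<longlongrightarrow> 0) F"
  shows "((\<lambda>n. L2_inner (fn n) (gn n)) \<longlongrightarrow> L2_inner f g) F"
proof -
  define a b where "a n = L2_norm (\<lambda>x. fn n x - f x)" and "b n = L2_norm (\<lambda>x. gn n x - g x)" for n
  have "\<forall>\<^sub>F n in F. norm (L2_inner (fn n) (gn n) - L2_inner f g) \<le>
      a n * b n + a n * L2_norm g + L2_norm f * b n"
    using fn gn
  proof eventually_elim
    case (elim n)
    let ?df = "\<lambda>x. fn n x - f x" and ?dg = "\<lambda>x. gn n x - g x"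
    have df: "?df \<in> L2" and dg: "?dg \<in> L2" by (intro L2_diff elim f g)+
    have "L2_inner (fn n) (gn n) - L2_inner f g =
        L2_inner ?df ?dg + L2_inner ?df g + L2_inner f ?dg"
      using elim f g df
      by (simp add: L2_inner_diff_right)
        (simp add: L2_inner_commute[of ?df] L2_inner_diff_right L2_inner_commute)
    then show ?case
      using L2_inner_bound[OF df dg] L2_inner_bound[OF df g] L2_inner_bound[OF f dg]
      by (simp add: a_def b_def)
  qed
  moreover have "((\<lambda>n. a n * b n + a n * L2_norm g + L2_norm f * b n) \<longlongrightarrow> 0) F"
    using limf limg unfolding a_def b_def
    by (intro tendsto_add_zero tendsto_mult_zero tendsto_mult_left_zero tendsto_mult_right_zero)
  ultimately have "((\<lambda>n. L2_inner (fn n) (gn n) - L2_inner f g) \<longlongrightarrow> 0) F"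
    by (rule Lim_null_comparison)
  then show ?thesis by (rule LIM_zero_cancel)
qed

lemma L2_nn_integral:
  assumes "f \<in> L2"
  shows "(\<integral>\<^sup>+x. ennreal ((norm (f x))\<^sup>2) \<partial>lebesgue) = ennreal ((L2_norm f)\<^sup>2)"
  using assms by (subst nn_integral_eq_integral) (auto simp: L2_def L2_norm_def)

lemma L2_if_nn_integral_le:
  assumes f: "f \<in> borel_measurable lebesgue" and "0 \<le> e"
    and square_le: "(\<integral>\<^sup>+x. ennreal ((norm (f x))\<^sup>2) \<partial>lebesgue) \<le> ennreal (e\<^sup>2)"
  shows "f \<in> L2" "L2_norm f \<le> e"
proof -
  note [measurable] = f
  show "f \<in> L2"
    unfolding L2_def mem_Collect_eq using square_le
    by (auto simp: integrable_iff_bounded intro: le_less_trans)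
  then have "(L2_norm f)\<^sup>2 \<le> e\<^sup>2" using square_le by (simp add: L2_nn_integral)
  then show "L2_norm f \<le> e" using \<open>0 \<le> e\<close> by (rule power2_le_imp_le)
qed

lemma L2_affine: "f \<in> L2 \<Longrightarrow> c \<noteq> 0 \<Longrightarrow> (\<lambda>x. f (t + c *\<^sub>R x)) \<in> L2"
  using integrable_lebesgue_affine_iff[of c "\<lambda>x. (norm (f x))\<^sup>2" t]
  by (simp add: L2_def borel_measurable_lebesgue_affine_iff)

lemma L2_translate: "f \<in> L2 \<Longrightarrow> (\<lambda>x. f (x - h)) \<in> L2"
  using L2_affine[of f 1 "- h"] by simp

lemma L2_norm_translate: "L2_norm (\<lambda>x. f (x - h)) = L2_norm f"
  unfolding L2_norm_def by (simp add: integral_lebesgue_translate[of "\<lambda>x. (norm (f x))\<^sup>2"])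

lemma Linf_measurable [measurable_dest]: "q \<in> Linf \<Longrightarrow> q \<in> borel_measurable lebesgue"
  by (simp add: Linf_def)

lemma esssup_abs_nonneg: "0 \<le> esssup lebesgue (\<lambda>x::'a::euclidean_space. ereal \<bar>q x\<bar>)"
  using esssup_const[of "lebesgue :: 'a measure" "0::ereal"]
    esssup_mono[of "\<lambda>_. 0" lebesgue "\<lambda>x. ereal \<bar>q x\<bar>"] by simp

lemma Linf_norm_nonneg: "0 \<le> Linf_norm q"
  unfolding Linf_norm_def using esssup_abs_nonneg by (rule real_of_ereal_pos)

lemma AE_abs_le_Linf_norm:
  assumes "q \<in> Linf"
  shows "AE x in lebesgue. \<bar>q x\<bar> \<le> Linf_norm q"
  using esssup_AE[where M = lebesgue and f = "\<lambda>x. ereal \<bar>q x\<bar>"]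
proof eventually_elim
  case (elim x)
  with assms show ?case
    by (cases "esssup lebesgue (\<lambda>x. ereal \<bar>q x\<bar>)") (auto simp: Linf_def Linf_norm_def)
qed

lemma
  assumes q: "q \<in> borel_measurable lebesgue" "AE x in lebesgue. \<bar>q x\<bar> \<le> C"
  shows Linf_if_AE_le: "q \<in> Linf" and Linf_norm_le: "Linf_norm q \<le> C"
proof -
  have "esssup lebesgue (\<lambda>x. ereal \<bar>q x\<bar>) \<le> ereal C"
    using q by (intro esssup_I) auto
  then show "q \<in> Linf" "Linf_norm q \<le> C"
    using q(1) esssup_abs_nonneg[of q] unfolding Linf_def Linf_norm_def
    by (cases "esssup lebesgue (\<lambda>x. ereal \<bar>q x\<bar>)"; simp)+
qed

lemma
  assumes "p \<in> Linf" "q \<in> Linf"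
  shows Linf_diff: "(\<lambda>x. p x - q x) \<in> Linf"
    and Linf_norm_diff_le: "Linf_norm (\<lambda>x. p x - q x) \<le> Linf_norm p + Linf_norm q"
proof -
  have "AE x in lebesgue. \<bar>p x - q x\<bar> \<le> Linf_norm p + Linf_norm q"
    using AE_abs_le_Linf_norm[OF assms(1)] AE_abs_le_Linf_norm[OF assms(2)] by eventually_elim simp
  moreover have "(\<lambda>x. p x - q x) \<in> borel_measurable lebesgue"
    using assms by measurable
  ultimately show "(\<lambda>x. p x - q x) \<in> Linf" "Linf_norm (\<lambda>x. p x - q x) \<le> Linf_norm p + Linf_norm q"
    by (auto intro: Linf_if_AE_le Linf_norm_le)
qed

lemma
  assumes "q \<in> Linf" "c \<noteq> 0"
  shows Linf_affine: "(\<lambda>x. q (t + c *\<^sub>R x)) \<in> Linf"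
    and Linf_norm_affine_le: "Linf_norm (\<lambda>x. q (t + c *\<^sub>R x)) \<le> Linf_norm q"
  using borel_measurable_lebesgue_affine_iff[of c q t] Linf_measurable[OF assms(1)]
    AE_lebesgue_affine[OF AE_abs_le_Linf_norm[OF assms(1)] assms(2), of t] assms(2)
  by (auto intro: Linf_if_AE_le Linf_norm_le)

lemma
  assumes q: "q \<in> Linf" and f: "f \<in> L2"
  shows Linf_scaleR_L2: "(\<lambda>x. q x *\<^sub>R f x) \<in> L2"
    and L2_norm_Linf_scaleR_le: "L2_norm (\<lambda>x. q x *\<^sub>R f x) \<le> Linf_norm q * L2_norm f"
proof -
  note [measurable] = Linf_measurable[OF q] L2_measurable[OF f]
  have bound: "AE x in lebesgue. (norm (q x *\<^sub>R f x))\<^sup>2 \<le> (Linf_norm q)\<^sup>2 * (norm (f x))\<^sup>2"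
    using AE_abs_le_Linf_norm[OF q]
  proof eventually_elim
    case (elim x)
    from power_mono[OF this, of 2] show ?case by (simp add: power_mult_distrib mult_right_mono)
  qed
  have f2: "integrable lebesgue (\<lambda>x. (Linf_norm q)\<^sup>2 * (norm (f x))\<^sup>2)"
    using L2_square_integrable[OF f] by simp
  then have qf2: "integrable lebesgue (\<lambda>x. (norm (q x *\<^sub>R f x))\<^sup>2)"
    by (rule Bochner_Integration.integrable_bound) (use bound in auto)
  then show "(\<lambda>x. q x *\<^sub>R f x) \<in> L2" by (simp add: L2_def)
  from real_sqrt_le_mono[OF integral_mono_AE[OF qf2 f2 bound]]
  show "L2_norm (\<lambda>x. q x *\<^sub>R f x) \<le> Linf_norm q * L2_norm f"
    by (simp add: L2_norm_def real_sqrt_mult Linf_norm_nonneg)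
qed

lemma integrable_scaleR_Linf:
  assumes k: "integrable lebesgue k" and q: "q \<in> Linf"
  shows "integrable lebesgue (\<lambda>x. k x *\<^sub>R q x)"
proof (rule Bochner_Integration.integrable_bound)
  note [measurable] = borel_measurable_integrable[OF k] Linf_measurable[OF q]
  show "(\<lambda>x. k x *\<^sub>R q x) \<in> borel_measurable lebesgue" by measurable
  show "integrable lebesgue (\<lambda>x. Linf_norm q * k x)" using k by simp
  show "AE x in lebesgue. norm (k x *\<^sub>R q x) \<le> norm (Linf_norm q * k x)"
    using AE_abs_le_Linf_norm[OF q]
  proof eventually_elim
    case (elim x)
    from mult_left_mono[OF this, of "\<bar>k x\<bar>"] show ?case
      by (simp add: abs_mult Linf_norm_nonneg mult.commute)
  qed
qed

section \<open>Continuity of translations\<close>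

lemma indicator_L1_approx_continuous:
  fixes A :: "'a::euclidean_space set"
  assumes A: "A \<in> sets lebesgue" "emeasure lebesgue A < \<infinity>" and "0 < e"
  obtains g :: "'a \<Rightarrow> real" where "continuous_on UNIV g" "integrable lebesgue g"
    "(LINT x|lebesgue. \<bar>indicator A x - g x\<bar>) < e"
proof -
  obtain K where K: "closed K" "K \<subseteq> A" "A - K \<in> lmeasurable"
    "emeasure lebesgue (A - K) < ennreal (e / 2)"
    using sets_lebesgue_inner_closed[OF A(1), of "e / 2"] \<open>0 < e\<close> by auto
  obtain U where U: "open U" "A \<subseteq> U" "U - A \<in> lmeasurable"
    "emeasure lebesgue (U - A) < ennreal (e / 2)"
    using sets_lebesgue_outer_open[OF A(1), of "e / 2"] \<open>0 < e\<close> by auto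
  obtain g :: "'a \<Rightarrow> real" where g: "continuous_on UNIV g" "\<And>x. g x \<in> closed_segment 1 0"
    "\<And>x. x \<in> K \<Longrightarrow> g x = 1" "\<And>x. x \<in> - U \<Longrightarrow> g x = 0"
    using Urysohn[of K "- U" 1 "0::real"] K U by blast
  have error_le: "\<bar>indicator A x - g x\<bar> \<le> indicator (A - K) x + indicator (U - A) x" for x
    using g(2,3,4)[of x] U(2) K(2) by (auto simp: indicator_def closed_segment_eq_real_ivl)
  have sets: "integrable lebesgue (indicator A :: 'a \<Rightarrow> real)"
    "integrable lebesgue (indicator (A - K) :: 'a \<Rightarrow> real)"
    "integrable lebesgue (indicator (U - A) :: 'a \<Rightarrow> real)"
    using A K(3) U(3) by (auto simp: fmeasurable_def)
  have [measurable]: "A \<in> sets lebesgue" "g \<in> borel_measurable lebesgue"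
    using A(1) borel_measurable_continuous_onI[OF g(1)]
    by (auto intro: borel_measurable_lebesgue_if_borel)
  have int: "integrable lebesgue (\<lambda>x. indicator A x - g x)"
    by (rule Bochner_Integration.integrable_bound[OF
          Bochner_Integration.integrable_add[OF sets(2,3)]])
      (use error_le in \<open>auto intro: order_trans[OF _ abs_ge_self]\<close>)
  have "integrable lebesgue g"
    using Bochner_Integration.integrable_diff[OF sets(1) int] by simp
  moreover have "(LINT x|lebesgue. \<bar>indicator A x - g x\<bar>) < e"
  proof -
    have "(LINT x|lebesgue. \<bar>indicator A x - g x\<bar>) \<le>
        (LINT x|lebesgue. indicator (A - K) x + indicator (U - A) x)"
      using int sets by (intro integral_mono error_le) auto
    also have "\<dots> = measure lebesgue (A - K) + measure lebesgue (U - A)"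
      using sets by simp
    also have "\<dots> < e / 2 + e / 2"
      using K(3,4) U(3,4)
      by (intro add_strict_mono) (auto simp: emeasure_eq_measure2 ennreal_less_iff)
    finally show ?thesis by simp
  qed
  ultimately show thesis by (rule that[OF g(1)])
qed

lemma L1_norm_diff_triangle:
  fixes f g h :: "'a \<Rightarrow> 'b::{banach, second_countable_topology}"
  assumes "integrable M f" "integrable M g" "integrable M h"
  shows "(LINT x|M. norm (f x - h x)) \<le> (LINT x|M. norm (f x - g x)) + (LINT x|M. norm (g x - h x))"
proof -
  have "(LINT x|M. norm (f x - h x)) \<le> (LINT x|M. norm (f x - g x) + norm (g x - h x))"
    using assms by (intro integral_mono norm_diff_triangle_le[OF order_refl order_refl]) auto
  also have "\<dots> = (LINT x|M. norm (f x - g x)) + (LINT x|M. norm (g x - h x))"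
    using assms by simp
  finally show ?thesis .
qed

lemma L1_dominated_convergence:
  fixes f :: "'a \<Rightarrow> 'b::{banach, second_countable_topology}"
  assumes f: "integrable M f" and s: "\<And>i. s i \<in> borel_measurable M" and w: "integrable M w"
    and lim: "AE x in M. (\<lambda>i. s i x) \<longlonglongrightarrow> f x" and bound: "\<And>i. AE x in M. norm (s i x) \<le> w x"
  shows "(\<lambda>i. LINT x|M. norm (f x - s i x)) \<longlonglongrightarrow> 0"
proof -
  note [measurable] = borel_measurable_integrable[OF f] s
  have "(\<lambda>i. LINT x|M. norm (f x - s i x)) \<longlonglongrightarrow> (LINT x|M. 0)"
  proof (rule integral_dominated_convergence)
    show "integrable M (\<lambda>x. norm (f x) + w x)" using f w by auto
    show "AE x in M. (\<lambda>i. norm (f x - s i x)) \<longlonglongrightarrow> 0"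
      using lim
    proof eventually_elim
      case (elim x)
      from tendsto_norm_zero[OF LIM_zero[OF this]] show ?case by (simp add: norm_minus_commute)
    qed
    show "AE x in M. norm (norm (f x - s i x)) \<le> norm (f x) + w x" for i
      using bound[of i]
    proof eventually_elim
      case (elim x)
      with norm_triangle_ineq4[of "f x" "s i x"] show ?case by simp
    qed
  qed measurable
  then show ?thesis by simp
qed

lemma integrable_L1_approx_continuous:
  fixes f :: "'a::euclidean_space \<Rightarrow> 'b::{banach, second_countable_topology}"
  assumes "integrable lebesgue f" "0 < e"
  shows "\<exists>g. continuous_on UNIV g \<and> integrable lebesgue g \<and> (LINT x|lebesgue. norm (f x - g x)) < e"
  using assms
proof (induction arbitrary: e rule: integrable_induct)
  case (base A c)
  have "0 < e / (norm c + 1)" using base(3) by (simp add: add_nonneg_pos)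
  from indicator_L1_approx_continuous[OF base(1,2) this] obtain g :: "'a \<Rightarrow> real"
    where g: "continuous_on UNIV g" "integrable lebesgue g"
      "(LINT x|lebesgue. \<bar>indicator A x - g x\<bar>) < e / (norm c + 1)" .
  have "(LINT x|lebesgue. norm (indicator A x *\<^sub>R c - g x *\<^sub>R c)) =
      (LINT x|lebesgue. \<bar>indicator A x - g x\<bar>) * norm c"
    by (simp flip: scaleR_diff_left)
  also have "\<dots> \<le> (LINT x|lebesgue. \<bar>indicator A x - g x\<bar>) * (norm c + 1)"
    by (intro mult_left_mono) auto
  also have "\<dots> < e" using g(3) by (simp add: pos_less_divide_eq add_nonneg_pos)
  finally show ?case
    using g by (intro exI[of _ "\<lambda>x. g x *\<^sub>R c"]) (auto intro!: continuous_intros)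
next
  case (add f1 f2)
  obtain g1 where g1: "continuous_on UNIV g1" "integrable lebesgue g1"
    "(LINT x|lebesgue. norm (f1 x - g1 x)) < e / 2"
    using add.IH(1)[of "e / 2"] \<open>0 < e\<close> by auto
  obtain g2 where g2: "continuous_on UNIV g2" "integrable lebesgue g2"
    "(LINT x|lebesgue. norm (f2 x - g2 x)) < e / 2"
    using add.IH(2)[of "e / 2"] \<open>0 < e\<close> by auto
  have "(LINT x|lebesgue. norm (f1 x + f2 x - (g1 x + g2 x))) \<le>
      (LINT x|lebesgue. norm (f1 x - g1 x) + norm (f2 x - g2 x))"
    using add.hyps g1(2) g2(2) by (intro integral_mono norm_diff_triangle_ineq) auto
  also have "\<dots> < e" using add.hyps g1(2,3) g2(2,3) by simp
  finally show ?case
    using g1 g2 by (intro exI[of _ "\<lambda>x. g1 x + g2 x"]) (auto intro!: continuous_intros)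
next
  case (lim f s)
  have "(\<lambda>i. LINT x|lebesgue. norm (f x - s i x)) \<longlonglongrightarrow> 0"
    using lim.hyps by (intro L1_dominated_convergence[where w = "\<lambda>x. 2 * norm (f x)"]) auto
  from order_tendstoD(2)[OF this, of "e / 2"] \<open>0 < e\<close> obtain i
    where i: "(LINT x|lebesgue. norm (f x - s i x)) < e / 2"
    by (auto simp: eventually_sequentially)
  obtain g where g: "continuous_on UNIV g" "integrable lebesgue g"
    "(LINT x|lebesgue. norm (s i x - g x)) < e / 2"
    using lim.IH[of "e / 2" i] \<open>0 < e\<close> by auto
  have "(LINT x|lebesgue. norm (f x - g x)) < e"
    using L1_norm_diff_triangle[OF lim.hyps(4) lim.hyps(1)[of i] g(2)] g(3) i by simp
  then show ?case using g by blast
qed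

lemma L1_translate_tendsto_continuous:
  fixes g :: "'a::euclidean_space \<Rightarrow> 'b::{banach, second_countable_topology}"
  assumes cont: "continuous_on UNIV g" and int: "integrable lebesgue g"
  shows "((\<lambda>h. LINT x|lebesgue. norm (g (x - h) - g x)) \<longlongrightarrow> 0) (at 0)"
  unfolding tendsto_at_iff_sequentially
proof (intro allI impI)
  fix h :: "nat \<Rightarrow> 'a" assume h: "h \<longlonglongrightarrow> 0"
  have shift: "integrable lebesgue (\<lambda>x. g (x - h n))" for n
    using int by (simp add: integrable_lebesgue_translate_iff)
  have "(\<lambda>n. \<integral>\<^sup>+x. ennreal (norm (g (x - h n) - g x)) \<partial>lebesgue) \<longlonglongrightarrow> 0"
  proof (rule Scheffe_lemma2)
    show "AE x in lebesgue. (\<lambda>n. g (x - h n)) \<longlonglongrightarrow> g x"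
    proof (rule AE_I2)
      fix x
      have "(\<lambda>n. x - h n) \<longlonglongrightarrow> x" using tendsto_diff[OF tendsto_const h, of x] by simp
      then show "(\<lambda>n. g (x - h n)) \<longlonglongrightarrow> g x"
        by (rule continuous_on_tendsto_compose[OF cont]) auto
    qed
    show "(\<integral>\<^sup>+x. ennreal (norm (g (x - h n))) \<partial>lebesgue) \<le>
        (\<integral>\<^sup>+x. ennreal (norm (g x)) \<partial>lebesgue)" for n
      using int shift[of n] integral_lebesgue_translate[of "\<lambda>x. norm (g x)" "h n"]
      by (simp add: nn_integral_eq_integral)
  qed (use int shift in auto)
  then have "(\<lambda>n. ennreal (LINT x|lebesgue. norm (g (x - h n) - g x))) \<longlonglongrightarrow> ennreal 0"
    using int shift by (simp add: nn_integral_eq_integral)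
  then show "((\<lambda>h. LINT x|lebesgue. norm (g (x - h) - g x)) \<circ> h) \<longlonglongrightarrow> 0"
    unfolding comp_def by (rule tendsto_ennrealD) auto
qed

lemma L1_translate_tendsto:
  fixes f :: "'a::euclidean_space \<Rightarrow> 'b::{banach, second_countable_topology}"
  assumes f: "integrable lebesgue f"
  shows "((\<lambda>h. LINT x|lebesgue. norm (f (x - h) - f x)) \<longlongrightarrow> 0) (at 0)"
proof (rule tendstoI)
  fix e :: real assume "0 < e"
  then obtain g where g: "continuous_on UNIV g" "integrable lebesgue g"
    "(LINT x|lebesgue. norm (f x - g x)) < e / 3"
    using integrable_L1_approx_continuous[OF f, of "e / 3"] by auto
  have "\<forall>\<^sub>F h in at 0. (LINT x|lebesgue. norm (g (x - h) - g x)) < e / 3"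
    using order_tendstoD(2)[OF L1_translate_tendsto_continuous[OF g(1,2)], of "e / 3"] \<open>0 < e\<close>
    by simp
  then show "\<forall>\<^sub>F h in at 0. dist (LINT x|lebesgue. norm (f (x - h) - f x)) 0 < e"
  proof eventually_elim
    case (elim h)
    have shift: "integrable lebesgue (\<lambda>x. f (x - h))" "integrable lebesgue (\<lambda>x. g (x - h))"
      using f g(2) by (simp_all add: integrable_lebesgue_translate_iff)
    have "(LINT x|lebesgue. norm (f (x - h) - f x)) \<le>
        (LINT x|lebesgue. norm (f (x - h) - g (x - h))) +
        ((LINT x|lebesgue. norm (g (x - h) - g x)) + (LINT x|lebesgue. norm (g x - f x)))"
      using L1_norm_diff_triangle[OF shift f] L1_norm_diff_triangle[OF shift(2) g(2) f] by linarith
    also have "(LINT x|lebesgue. norm (f (x - h) - g (x - h))) =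
        (LINT x|lebesgue. norm (f x - g x))"
      by (rule integral_lebesgue_translate[of "\<lambda>x. norm (f x - g x)"])
    finally show ?case using elim g(3) by (simp add: norm_minus_commute)
  qed
qed

text \<open>
  The Mazur map \<open>a \<mapsto> \<bar>a\<bar> a\<close> carries \<open>L\<^sup>2\<close> to \<open>L\<^sup>1\<close>; this inequality makes its inverse continuous,
  so that continuity of translations in \<open>L\<^sup>2\<close> is inherited from \<open>L\<^sup>1\<close>.
\<close>

lemma norm_diff_square_le_Mazur:
  fixes a b :: "'a::real_inner"
  shows "(norm (a - b))\<^sup>2 \<le> 2 * norm (norm a *\<^sub>R a - norm b *\<^sub>R b)"
proof (cases "a = b")
  case False
  let ?D = "norm a *\<^sub>R a - norm b *\<^sub>R b"
  have "norm (a - b) * (norm (a - b))\<^sup>2 \<le> (norm a + norm b) * (norm (a - b))\<^sup>2"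
    by (intro mult_right_mono norm_triangle_ineq4) simp
  also have "\<dots> \<le> (norm a + norm b) * (norm (a - b))\<^sup>2 + (norm a + norm b) * (norm a - norm b)\<^sup>2"
    by simp
  also have "\<dots> = 2 * (?D \<bullet> (a - b))"
  proof -
    have "(norm (a - b))\<^sup>2 = (norm a)\<^sup>2 + (norm b)\<^sup>2 - 2 * (a \<bullet> b)"
      by (simp add: power2_norm_eq_inner inner_diff inner_commute)
    then show ?thesis
      by (simp only:)
        (simp add: inner_diff inner_commute dot_square_norm power2_eq_square algebra_simps)
  qed
  also have "\<dots> \<le> 2 * (norm ?D * norm (a - b))"
    by (simp add: norm_cauchy_schwarz)
  finally show ?thesis using False by (simp add: mult.commute)
qed simp

lemma L2_translate_tendsto:
  assumes f: "f \<in> L2"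
  shows "((\<lambda>h. L2_norm (\<lambda>x. f (x - h) - f x)) \<longlongrightarrow> 0) (at 0)"
proof -
  note [measurable] = L2_measurable[OF f]
  define G where "G x = norm (f x) *\<^sub>R f x" for x
  let ?L1 = "\<lambda>h. LINT x|lebesgue. norm (G (x - h) - G x)"
  have "integrable lebesgue (\<lambda>x. norm (G x))"
    using L2_square_integrable[OF f] by (simp add: G_def power2_eq_square)
  then have G: "integrable lebesgue G"
    by (subst (asm) integrable_norm_iff) (simp_all add: G_def[abs_def])
  have translate_le: "L2_norm (\<lambda>x. f (x - h) - f x) \<le> sqrt (2 * ?L1 h)" for h
  proof -
    have "integrable lebesgue (\<lambda>x. G (x - h))"
      using G by (simp add: integrable_lebesgue_translate_iff)
    moreover have "(norm (f (x - h) - f x))\<^sup>2 \<le> 2 * norm (G (x - h) - G x)" for x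
      unfolding G_def by (rule norm_diff_square_le_Mazur)
    ultimately have "(LINT x|lebesgue. (norm (f (x - h) - f x))\<^sup>2) \<le>
        (LINT x|lebesgue. 2 * norm (G (x - h) - G x))"
      using G L2_square_integrable[OF L2_diff[OF L2_translate[OF f] f]]
      by (intro integral_mono) auto
    then show ?thesis by (simp add: L2_norm_def)
  qed
  have "((\<lambda>h. sqrt (2 * ?L1 h)) \<longlongrightarrow> 0) (at 0)"
    using tendsto_real_sqrt[OF tendsto_mult_right_zero[OF L1_translate_tendsto[OF G]]] by simp
  then show ?thesis by (rule Lim_null_comparison[rotated]) (simp add: translate_le)
qed

lemma L2_translate_diff_scaleR_tendsto:
  assumes q: "q \<in> Linf" and u: "u \<in> L2"
  shows "((\<lambda>h. L2_norm (\<lambda>x. (q (x - h) - q x) *\<^sub>R u x)) \<longlongrightarrow> 0) (at 0)"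
proof -
  note qu = Linf_scaleR_L2[OF q u]
  let ?B = "\<lambda>h. Linf_norm q * L2_norm (\<lambda>x. u (x - h) - u x) +
    L2_norm (\<lambda>x. q (x - h) *\<^sub>R u (x - h) - q x *\<^sub>R u x)"
  have commutator_le: "L2_norm (\<lambda>x. (q (x - h) - q x) *\<^sub>R u x) \<le> ?B h" for h
  proof -
    have qh: "(\<lambda>x. q (x - h)) \<in> Linf" "Linf_norm (\<lambda>x. q (x - h)) \<le> Linf_norm q"
      using Linf_affine[OF q, of 1 "- h"] Linf_norm_affine_le[OF q, of 1 "- h"] by simp_all
    have du: "(\<lambda>x. u (x - h) - u x) \<in> L2" by (intro L2_diff L2_translate u)
    have "L2_norm (\<lambda>x. (q (x - h) - q x) *\<^sub>R u x) =
        L2_norm (\<lambda>x. (q (x - h) *\<^sub>R u (x - h) - q x *\<^sub>R u x) - q (x - h) *\<^sub>R (u (x - h) - u x))"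
      by (simp add: algebra_simps)
    also have "\<dots> \<le> L2_norm (\<lambda>x. q (x - h) *\<^sub>R u (x - h) - q x *\<^sub>R u x) +
        L2_norm (\<lambda>x. q (x - h) *\<^sub>R (u (x - h) - u x))"
      by (intro L2_norm_diff_le L2_diff L2_translate[OF qu] qu Linf_scaleR_L2[OF qh(1) du])
    also have "L2_norm (\<lambda>x. q (x - h) *\<^sub>R (u (x - h) - u x)) \<le>
        Linf_norm q * L2_norm (\<lambda>x. u (x - h) - u x)"
      by (rule order_trans[OF L2_norm_Linf_scaleR_le[OF qh(1) du] mult_right_mono[OF qh(2)]]) simp
    finally show ?thesis by simp
  qed
  have "(?B \<longlongrightarrow> 0) (at 0)"
    by (intro tendsto_add_zero tendsto_mult_right_zero L2_translate_tendsto u qu)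
  then show ?thesis by (rule Lim_null_comparison[rotated]) (simp add: commutator_le)
qed

section \<open>Test functions\<close>

lemma has_derivative_affine:
  fixes f :: "'a::real_normed_vector \<Rightarrow> real"
  assumes "f differentiable (at (a + s *\<^sub>R y))"
  shows "((\<lambda>y. c * f (a + s *\<^sub>R y)) has_derivative
    (\<lambda>h. c * frechet_derivative f (at (a + s *\<^sub>R y)) (s *\<^sub>R h))) (at y)"
proof -
  have "((\<lambda>y. a + s *\<^sub>R y) has_derivative (\<lambda>h. s *\<^sub>R h)) (at y)"
    by (auto intro!: derivative_eq_intros)
  moreover have "(f has_derivative frechet_derivative f (at (a + s *\<^sub>R y))) (at (a + s *\<^sub>R y))"
    using assms by (simp add: frechet_derivative_works)
  ultimately show ?thesis
    by (rule has_derivative_mult_right[OF has_derivative_compose])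
qed

lemma partial_affine:
  assumes "f differentiable (at (a + s *\<^sub>R y))"
  shows "partial b (\<lambda>y. c * f (a + s *\<^sub>R y)) y = (c * s) * partial b f (a + s *\<^sub>R y)"
  unfolding partial_def frechet_derivative_at[OF has_derivative_affine[OF assms], symmetric]
  using linear_scale[OF linear_frechet_derivative[OF assms], of s b] by simp

lemma smooth_iterated_partial_differentiable:
  "smooth f \<Longrightarrow> set bs \<subseteq> Basis \<Longrightarrow> foldr partial bs f differentiable (at x)"
  by (simp add: smooth_def)

lemma smooth_differentiable: "smooth f \<Longrightarrow> f differentiable (at x)"
  using smooth_iterated_partial_differentiable[of f "[]"] by simp

lemma iterated_partial_affine:
  assumes "smooth f" "set bs \<subseteq> Basis"
  shows "foldr partial bs (\<lambda>y. c * f (a + s *\<^sub>R y)) =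
    (\<lambda>y. (c * s ^ length bs) * foldr partial bs f (a + s *\<^sub>R y))"
  using assms(2)
proof (induction bs)
  case (Cons b bs)
  have "partial b (\<lambda>y. (c * s ^ length bs) * foldr partial bs f (a + s *\<^sub>R y)) =
      (\<lambda>y. (c * s ^ length bs * s) * partial b (foldr partial bs f) (a + s *\<^sub>R y))"
    using Cons.prems
    by (intro ext partial_affine smooth_iterated_partial_differentiable assms(1)) simp
  with Cons show ?case by (simp add: mult.assoc mult.commute[of s])
qed simp

lemma smooth_affine:
  assumes "smooth f"
  shows "smooth (\<lambda>y. c * f (a + s *\<^sub>R y))"
  unfolding smooth_def
proof (intro allI impI)
  fix bs :: "'a list" and x :: 'a
  assume bs: "set bs \<subseteq> Basis"
  show "foldr partial bs (\<lambda>y. c * f (a + s *\<^sub>R y)) differentiable (at x)"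
    unfolding iterated_partial_affine[OF assms bs]
    by (rule differentiableI has_derivative_affine smooth_iterated_partial_differentiable assms bs)+
qed

lemma smooth_partial:
  assumes "smooth f" "b \<in> Basis"
  shows "smooth (partial b f)"
  unfolding smooth_def
proof (intro allI impI)
  fix bs :: "'a list" and x :: 'a
  assume "set bs \<subseteq> Basis"
  then show "foldr partial bs (partial b f) differentiable (at x)"
    using smooth_iterated_partial_differentiable[OF assms(1), of "bs @ [b]"] assms(2) by simp
qed

lemma test_function_differentiable: "test_function f \<Longrightarrow> f differentiable (at x)"
  by (simp add: test_function_def smooth_differentiable)

lemma test_function_affine:
  assumes f: "test_function f" and "s \<noteq> 0"
  shows "test_function (\<lambda>y. c * f (a + s *\<^sub>R y))"
proof -
  have "y \<in> (\<lambda>z. (1 / s) *\<^sub>R (z - a)) ` {x. f x \<noteq> 0}" if "f (a + s *\<^sub>R y) \<noteq> 0" for y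
    using that \<open>s \<noteq> 0\<close> by (intro image_eqI[of _ _ "a + s *\<^sub>R y"]) auto
  then have "{y. c * f (a + s *\<^sub>R y) \<noteq> 0} \<subseteq> (\<lambda>z. (1 / s) *\<^sub>R (z - a)) ` {x. f x \<noteq> 0}"
    by auto
  moreover have "bounded ((\<lambda>z. (1 / s) *\<^sub>R (z - a)) ` {x. f x \<noteq> 0})"
    using f bounded_scaling[OF bounded_translation_minus[of "{x. f x \<noteq> 0}" a], of "1 / s"]
    by (simp add: test_function_def compact_closure image_image)
  ultimately show ?thesis
    using f smooth_affine[of f c a s] bounded_subset
    by (auto simp: test_function_def compact_closure)
qed

lemma test_function_reflect:
  assumes "test_function k"
  shows "test_function (\<lambda>y. k (x - y))" "test_function (\<lambda>y. k (- y))"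
  using test_function_affine[OF assms, of "-1" 1 x] test_function_affine[OF assms, of "-1" 1 0]
  by auto

lemma partial_eq_0_outside_support:
  assumes "x \<notin> closure {x. f x \<noteq> 0}"
  shows "partial b f x = 0"
proof -
  let ?S = "closure {x. f x \<noteq> 0}"
  have "((\<lambda>_. 0) has_derivative (\<lambda>_. 0)) (at x)" "open (- ?S)" "x \<in> - ?S"
    using assms by auto
  then have "(f has_derivative (\<lambda>_. 0)) (at x)"
    by (rule has_derivative_transform_within_open)
      (use closure_subset[of "{x. f x \<noteq> 0}"] in auto)
  from frechet_derivative_at[OF this, symmetric] show ?thesis by (simp add: partial_def)
qed

lemma test_function_partial:
  assumes "test_function f" "b \<in> Basis"
  shows "test_function (partial b f)"
proof -
  have "{x. partial b f x \<noteq> 0} \<subseteq> closure {x. f x \<noteq> 0}"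
    using partial_eq_0_outside_support[of _ f b] by blast
  then have "compact (closure {x. partial b f x \<noteq> 0})"
    using assms(1) unfolding test_function_def compact_closure
    by (meson bounded_closure bounded_subset)
  with assms smooth_partial show ?thesis by (auto simp: test_function_def)
qed

lemma partial_reflect:
  assumes "test_function k"
  shows "partial b (\<lambda>y. k (x - y)) = (\<lambda>y. - partial b k (x - y))"
    and "partial b (\<lambda>y. k (- y)) = (\<lambda>y. - partial b k (- y))"
  using partial_affine[OF test_function_differentiable[OF assms], of b 1 x "-1"]
    partial_affine[OF test_function_differentiable[OF assms], of b 1 0 "-1"]
  by (simp_all add: fun_eq_iff)

lemma laplacian_reflect:
  assumes k: "test_function k"
  shows "laplacian (\<lambda>y. k (x - y)) y = laplacian k (x - y)"
  unfolding laplacian_def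
proof (rule sum.cong[OF refl])
  fix b :: 'a assume "b \<in> Basis"
  then have "test_function (\<lambda>y. partial b k (x - y))"
    by (intro test_function_reflect test_function_partial k)
  from partial_affine[OF test_function_differentiable[OF this], of b "-1" 0 1]
  have "partial b (\<lambda>y. - partial b k (x - y)) y = - partial b (\<lambda>y. partial b k (x - y)) y"
    by simp
  also have "\<dots> = partial b (partial b k) (x - y)"
    using \<open>b \<in> Basis\<close> k by (simp add: partial_reflect test_function_partial)
  finally show "partial b (partial b (\<lambda>y. k (x - y))) y = partial b (partial b k) (x - y)"
    by (simp add: partial_reflect k)
qed

lemma test_function_continuous: "test_function f \<Longrightarrow> continuous_on UNIV f"
  by (meson continuous_at_imp_continuous_on differentiable_imp_continuous_within
      test_function_differentiable)

lemma test_function_borel [measurable_dest]: "test_function f \<Longrightarrow> f \<in> borel_measurable borel"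
  by (intro borel_measurable_continuous_onI test_function_continuous)

lemma integrable_continuous_compact_support:
  fixes f :: "'a::euclidean_space \<Rightarrow> 'b::{banach, second_countable_topology}"
  assumes f: "continuous_on UNIV f" and S: "compact S" "\<And>x. x \<notin> S \<Longrightarrow> f x = 0"
  shows "integrable lebesgue f"
proof -
  have "integrable lborel (\<lambda>x. indicator S x *\<^sub>R f x)"
    using S(1) f by (intro borel_integrable_compact) (auto intro: continuous_on_subset)
  moreover have "(\<lambda>x. indicator S x *\<^sub>R f x) = f"
    using S(2) by (auto simp: fun_eq_iff indicator_def)
  ultimately show ?thesis
    using borel_measurable_continuous_onI[OF f] by (simp add: integrable_completion)
qed

lemma
  assumes "test_function f"
  shows test_function_integrable: "integrable lebesgue f"
    and test_function_square_integrable: "integrable lebesgue (\<lambda>x. (f x)\<^sup>2)"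
proof -
  have S: "compact (closure {x. f x \<noteq> 0})" "\<And>x. x \<notin> closure {x. f x \<noteq> 0} \<Longrightarrow> f x = 0"
    using assms closure_subset[of "{x. f x \<noteq> 0}"] by (auto simp: test_function_def)
  note cont = test_function_continuous[OF assms]
  show "integrable lebesgue f"
    by (rule integrable_continuous_compact_support[OF cont S])
  show "integrable lebesgue (\<lambda>x. (f x)\<^sup>2)"
    by (rule integrable_continuous_compact_support[OF continuous_on_power[OF cont] S(1)])
      (drule S(2), simp)
qed

lemma test_function_scaleR_L2_integrable:
  assumes \<phi>: "test_function \<phi>" and f: "f \<in> L2"
  shows "integrable lebesgue (\<lambda>x. \<phi> x *\<^sub>R f x)"
proof -
  note [measurable] =
    borel_measurable_lebesgue_if_borel[OF test_function_borel[OF \<phi>]] L2_measurable[OF f]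
  have "integrable lebesgue (\<lambda>x. norm (\<phi> x) * norm (f x))"
    using test_function_square_integrable[OF \<phi>] L2_square_integrable[OF f]
    by (intro integrable_norm_mult) simp_all
  then show ?thesis
    by (subst integrable_norm_iff[symmetric]) simp_all
qed

section \<open>Mollification\<close>

lemma convolve_eq_integral_translate:
  "convolve f k x = (LINT z|lebesgue. k z *\<^sub>R f (x - z))"
  unfolding convolve_def
  using integral_lebesgue_affine[of "-1" "\<lambda>y. k (x - y) *\<^sub>R f y" x] by simp

lemma convolve_cong_AE:
  assumes "AE x in lebesgue. f x = g x"
  shows "convolve f k = convolve g k"
proof
  fix x
  have "AE y in lebesgue. k (x - y) *\<^sub>R f y = k (x - y) *\<^sub>R g y"
    using assms by eventually_elim simp
  then show "convolve f k x = convolve g k x"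
    unfolding convolve_def by (rule completion.integral_cong_AE)
qed

lemma convolve_measurable:
  fixes f :: "'a::euclidean_space \<Rightarrow> 'b::euclidean_space"
  assumes f: "f \<in> borel_measurable lebesgue" and [measurable]: "k \<in> borel_measurable borel"
  shows "convolve f k \<in> borel_measurable lebesgue"
proof -
  obtain g where [measurable]: "g \<in> borel_measurable borel" and fg: "AE x in lebesgue. f x = g x"
    using ex_borel_version[OF f] .
  have "convolve f k = convolve g k" using fg by (rule convolve_cong_AE)
  also have "\<dots> = (\<lambda>x. LINT y|lborel. k (x - y) *\<^sub>R g y)"
    by (simp add: convolve_def[abs_def] integral_completion)
  also have "\<dots> \<in> borel_measurable lebesgue"
    by (rule measurable_completion) measurable
  finally show ?thesis .
qed

lemma (in prob_space) norm_expectation_square_le: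
  fixes f :: "'a \<Rightarrow> 'b::{banach, second_countable_topology}"
  assumes [measurable]: "f \<in> borel_measurable M"
  shows "ennreal ((norm (expectation f))\<^sup>2) \<le> (\<integral>\<^sup>+z. ennreal ((norm (f z))\<^sup>2) \<partial>M)"
proof -
  have "ennreal ((norm (expectation f))\<^sup>2) = (ennreal (norm (expectation f)))\<^sup>2"
    by (simp add: ennreal_power)
  also have "\<dots> \<le> (\<integral>\<^sup>+z. ennreal (norm (f z)) \<partial>M)\<^sup>2"
    by (cases "integrable M f")
      (auto simp: not_integrable_integral_eq intro!: power_mono integral_norm_bound_ennreal)
  also have "\<dots> \<le> (\<integral>\<^sup>+z. ennreal ((norm (f z))\<^sup>2) \<partial>M)"
    using Cauchy_Schwarz_nn_integral[of "\<lambda>z. ennreal (norm (f z))" M "\<lambda>_. 1"]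
    by (simp add: ennreal_power emeasure_space_1)
  finally show ?thesis .
qed

lemma
  fixes F :: "'a::euclidean_space \<Rightarrow> 'z \<Rightarrow> complex"
  assumes "prob_space M" and [measurable]: "case_prod F \<in> borel_measurable (lborel \<Otimes>\<^sub>M M)"
    and "0 \<le> e" and bound: "AE z in M. (\<lambda>x. F x z) \<in> L2 \<and> L2_norm (\<lambda>x. F x z) \<le> e"
  shows L2_expectation: "(\<lambda>x. LINT z|M. F x z) \<in> L2"
    and L2_norm_expectation_le: "L2_norm (\<lambda>x. LINT z|M. F x z) \<le> e"
proof -
  interpret M: prob_space M by fact
  interpret pair_sigma_finite lborel M ..
  have "(\<integral>\<^sup>+x. ennreal ((norm (LINT z|M. F x z))\<^sup>2) \<partial>lebesgue) \<le>
      (\<integral>\<^sup>+x. (\<integral>\<^sup>+z. ennreal ((norm (F x z))\<^sup>2) \<partial>M) \<partial>lborel)"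
    unfolding nn_integral_completion
    by (intro nn_integral_mono M.norm_expectation_square_le) measurable
  also have "\<dots> = (\<integral>\<^sup>+z. (\<integral>\<^sup>+x. ennreal ((norm (F x z))\<^sup>2) \<partial>lborel) \<partial>M)"
    by (rule Fubini'[symmetric]) measurable
  also have "\<dots> \<le> (\<integral>\<^sup>+z. ennreal (e\<^sup>2) \<partial>M)"
  proof (rule nn_integral_mono_AE)
    show "AE z in M. (\<integral>\<^sup>+x. ennreal ((norm (F x z))\<^sup>2) \<partial>lborel) \<le> ennreal (e\<^sup>2)"
      using bound
    proof eventually_elim
      case (elim z)
      then show ?case
        using L2_nn_integral[of "\<lambda>x. F x z"]
        by (simp add: nn_integral_completion ennreal_leI power_mono)
    qed
  qed
  also have "\<dots> = ennreal (e\<^sup>2)" by (simp add: M.emeasure_space_1)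
  finally have square_le: "(\<integral>\<^sup>+x. ennreal ((norm (LINT z|M. F x z))\<^sup>2) \<partial>lebesgue) \<le> ennreal (e\<^sup>2)" .
  have "(\<lambda>x. LINT z|M. F x z) \<in> borel_measurable lborel" by measurable
  then have "(\<lambda>x. LINT z|M. F x z) \<in> borel_measurable lebesgue" by (rule measurable_completion)
  from L2_if_nn_integral_le[OF this \<open>0 \<le> e\<close> square_le]
  show "(\<lambda>x. LINT z|M. F x z) \<in> L2" "L2_norm (\<lambda>x. LINT z|M. F x z) \<le> e" .
qed

lemma
  assumes "friedrichs_mollifier k"
  shows mollifier_test_function: "test_function k"
    and mollifier_nonneg: "0 \<le> k x"
    and mollifier_integral: "(LINT x|lebesgue. k x) = 1"
  using assms by (simp_all add: friedrichs_mollifier_def)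

lemma prob_space_mollifier:
  assumes k: "friedrichs_mollifier k"
  shows "prob_space (density lborel k)"
proof (rule prob_spaceI)
  note [measurable] = test_function_borel[OF mollifier_test_function[OF k]]
  have "(\<integral>\<^sup>+x. ennreal (k x) \<partial>lborel) = (\<integral>\<^sup>+x. ennreal (k x) \<partial>lebesgue)"
    by (rule nn_integral_completion[symmetric])
  also have "\<dots> = 1"
    using test_function_integrable[OF mollifier_test_function[OF k]] mollifier_nonneg[OF k]
    by (simp add: nn_integral_eq_integral mollifier_integral[OF k])
  finally show "emeasure (density lborel k) (space (density lborel k)) = 1"
    by (simp add: emeasure_density)
qed

lemma
  fixes f :: "'a::euclidean_space \<Rightarrow> 'b::{banach, second_countable_topology}"
  assumes k: "friedrichs_mollifier k" and [measurable]: "f \<in> borel_measurable borel"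
  shows convolve_eq_expectation: "convolve f k x = (LINT z|density lborel k. f (x - z))"
    and integrable_density_mollifier_iff:
      "integrable (density lborel k) (\<lambda>z. f (x - z)) \<longleftrightarrow> integrable lebesgue (\<lambda>z. k z *\<^sub>R f (x - z))"
proof -
  note [measurable] = test_function_borel[OF mollifier_test_function[OF k]]
  show "convolve f k x = (LINT z|density lborel k. f (x - z))"
    unfolding convolve_eq_integral_translate
    by (simp add: integral_density integral_completion mollifier_nonneg[OF k])
  show "integrable (density lborel k) (\<lambda>z. f (x - z)) \<longleftrightarrow> integrable lebesgue (\<lambda>z. k z *\<^sub>R f (x - z))"
    by (simp add: integrable_density integrable_completion mollifier_nonneg[OF k])
qed

lemma mollify_diff_eq_expectation:
  fixes f :: "'a::euclidean_space \<Rightarrow> 'b::euclidean_space"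
    and prod :: "'b \<Rightarrow> 'c::real_normed_vector \<Rightarrow> complex"
  assumes prod: "bounded_bilinear prod" and k: "friedrichs_mollifier k"
    and f: "f \<in> borel_measurable borel" and int: "integrable lebesgue (\<lambda>z. k z *\<^sub>R f (x - z))"
  shows "prod (convolve f k x - f x) w = (LINT z|density lborel k. prod (f (x - z) - f x) w)"
proof -
  interpret M: prob_space "density lborel k" using k by (rule prob_space_mollifier)
  have int': "integrable (density lborel k) (\<lambda>z. f (x - z))"
    using int by (simp only: integrable_density_mollifier_iff[OF k f])
  then have "convolve f k x - f x = (LINT z|density lborel k. f (x - z) - f x)"
    by (simp add: convolve_eq_expectation[OF k f] M.prob_space[simplified])
  then show ?thesis
    using integral_bounded_linear[OF bounded_bilinear.bounded_linear_left[OF prod, of w]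
        Bochner_Integration.integrable_diff[OF int' M.integrable_const[of "f x"]]]
    by simp
qed

lemma L2_mollify_diff_borel:
  fixes f :: "'a::euclidean_space \<Rightarrow> 'b::euclidean_space" and w :: "'a \<Rightarrow> 'c::euclidean_space"
    and prod :: "'b \<Rightarrow> 'c \<Rightarrow> complex"
  assumes prod: "bounded_bilinear prod" and k: "friedrichs_mollifier k"
    and [measurable]: "f \<in> borel_measurable borel" "w \<in> borel_measurable borel"
    and "0 \<le> e" and translate_le: "\<And>z. k z \<noteq> 0 \<Longrightarrow> (\<lambda>x. prod (f (x - z) - f x) (w x)) \<in> L2 \<and>
      L2_norm (\<lambda>x. prod (f (x - z) - f x) (w x)) \<le> e"
  defines "G \<equiv> (\<lambda>x. LINT z|density lborel k. prod (f (x - z) - f x) (w x))"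
  shows "G \<in> L2" "L2_norm G \<le> e"
proof -
  note [measurable] = test_function_borel[OF mollifier_test_function[OF k]]
  have "continuous_on UNIV (\<lambda>p. prod (fst p) (snd p))"
    by (intro bounded_bilinear.continuous_on[OF prod] continuous_intros)
  then have "(\<lambda>(x, z). prod (f (x - z) - f x) (w x)) \<in>
      borel_measurable (lborel \<Otimes>\<^sub>M density lborel k)"
    unfolding case_prod_unfold by (rule borel_measurable_continuous_Pair[rotated 2]) measurable
  moreover have "AE z in density lborel k. (\<lambda>x. prod (f (x - z) - f x) (w x)) \<in> L2 \<and>
      L2_norm (\<lambda>x. prod (f (x - z) - f x) (w x)) \<le> e"
    using translate_le by (subst AE_density) auto
  ultimately show "G \<in> L2" "L2_norm G \<le> e"
    unfolding G_def using prob_space_mollifier[OF k] \<open>0 \<le> e\<close>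
    by - (rule L2_expectation L2_norm_expectation_le; assumption)+
qed

lemma
  fixes f :: "'a::euclidean_space \<Rightarrow> 'b::euclidean_space" and w :: "'a \<Rightarrow> 'c::euclidean_space"
    and prod :: "'b \<Rightarrow> 'c \<Rightarrow> complex"
  assumes prod: "bounded_bilinear prod" and k: "friedrichs_mollifier k"
    and f: "f \<in> borel_measurable lebesgue" and w: "w \<in> borel_measurable lebesgue"
    and int: "\<And>x. integrable lebesgue (\<lambda>z. k z *\<^sub>R f (x - z))"
    and "0 \<le> e" and translate_le: "\<And>z. k z \<noteq> 0 \<Longrightarrow> (\<lambda>x. prod (f (x - z) - f x) (w x)) \<in> L2 \<and>
      L2_norm (\<lambda>x. prod (f (x - z) - f x) (w x)) \<le> e"
  shows L2_mollify_diff: "(\<lambda>x. prod (convolve f k x - f x) (w x)) \<in> L2"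
    and L2_norm_mollify_diff_le: "L2_norm (\<lambda>x. prod (convolve f k x - f x) (w x)) \<le> e"
proof -
  obtain f' where f': "f' \<in> borel_measurable borel" "AE x in lebesgue. f x = f' x"
    using ex_borel_version[OF f] .
  obtain w' where w': "w' \<in> borel_measurable borel" "AE x in lebesgue. w x = w' x"
    using ex_borel_version[OF w] .
  have translate_le': "(\<lambda>x. prod (f' (x - z) - f' x) (w' x)) \<in> L2 \<and>
      L2_norm (\<lambda>x. prod (f' (x - z) - f' x) (w' x)) \<le> e" if "k z \<noteq> 0" for z
  proof -
    have "AE x in lebesgue. prod (f (x - z) - f x) (w x) = prod (f' (x - z) - f' x) (w' x)"
      using AE_lebesgue_translate[OF f'(2), of z] f'(2) w'(2) by eventually_elim simp
    from L2_cong_AE[OF this] L2_norm_cong_AE[OF this] translate_le[OF that] show ?thesis by simp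
  qed
  have "AE x in lebesgue. prod (convolve f k x - f x) (w x) =
      (LINT z|density lborel k. prod (f' (x - z) - f' x) (w' x))"
    using f'(2) w'(2)
  proof eventually_elim
    case (elim x)
    have "AE z in lebesgue. k z *\<^sub>R f (x - z) = k z *\<^sub>R f' (x - z)"
      using AE_lebesgue_reflect[OF f'(2), of x] by eventually_elim simp
    with int[of x] have "integrable lebesgue (\<lambda>z. k z *\<^sub>R f' (x - z))"
      by (simp only: completion.integrable_cong_AE)
    from mollify_diff_eq_expectation[OF prod k f'(1) this] show ?case
      using elim by (simp add: convolve_cong_AE[OF f'(2)])
  qed
  from L2_cong_AE[OF this] L2_norm_cong_AE[OF this]
  show "(\<lambda>x. prod (convolve f k x - f x) (w x)) \<in> L2"
    "L2_norm (\<lambda>x. prod (convolve f k x - f x) (w x)) \<le> e"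
    using L2_mollify_diff_borel[OF prod k f'(1) w'(1) \<open>0 \<le> e\<close> translate_le'] by simp_all
qed

lemma mollifier_scaled:
  fixes \<psi> :: "'a::euclidean_space \<Rightarrow> real"
  assumes \<psi>: "friedrichs_mollifier \<psi>" and "0 < r"
  shows "friedrichs_mollifier (scaled \<psi> r)"
proof -
  have eq: "scaled \<psi> r = (\<lambda>x. (1 / r ^ DIM('a)) * \<psi> (0 + (1 / r) *\<^sub>R x))"
    by (simp add: scaled_def fun_eq_iff inverse_eq_divide)
  have "test_function (scaled \<psi> r)"
    unfolding eq using mollifier_test_function[OF \<psi>] \<open>0 < r\<close> by (intro test_function_affine) auto
  moreover have "0 \<le> scaled \<psi> r x" for x
    using mollifier_nonneg[OF \<psi>] \<open>0 < r\<close> by (simp add: scaled_def)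
  moreover have "(LINT x|lebesgue. scaled \<psi> r x) = 1"
  proof -
    have "(LINT x|lebesgue. scaled \<psi> r x) =
        \<bar>1 / r\<bar> ^ DIM('a) *\<^sub>R (LINT x|lebesgue. \<psi> (0 + (1 / r) *\<^sub>R x))"
      using \<open>0 < r\<close> by (simp add: eq power_divide)
    also have "\<dots> = (LINT x|lebesgue. \<psi> x)"
      using \<open>0 < r\<close> by (intro integral_lebesgue_affine[symmetric]) simp
    finally show ?thesis by (simp add: mollifier_integral[OF \<psi>])
  qed
  ultimately show ?thesis by (simp add: friedrichs_mollifier_def)
qed

lemma mollifier_reflect:
  assumes \<psi>: "friedrichs_mollifier \<psi>"
  shows "friedrichs_mollifier (\<lambda>x. \<psi> (- x))"
  using \<psi> integral_lebesgue_affine[of "-1" \<psi> 0]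
  by (simp add: friedrichs_mollifier_def test_function_reflect)

lemma eventually_scaled_support:
  assumes "test_function \<psi>" "eventually P (nhds 0)"
  shows "\<forall>\<^sub>F r in at_right 0. \<forall>z. scaled \<psi> r z \<noteq> 0 \<longrightarrow> P z"
proof -
  obtain d where d: "0 < d" "\<And>z. norm z < d \<Longrightarrow> P z"
    using assms(2) by (auto simp: eventually_nhds_metric)
  have "bounded {x. \<psi> x \<noteq> 0}"
    using assms(1) by (simp add: test_function_def compact_closure)
  then obtain R where R: "0 < R" "\<And>x. \<psi> x \<noteq> 0 \<Longrightarrow> norm x \<le> R"
    by (auto simp: bounded_pos)
  have "\<forall>\<^sub>F r in at_right 0. r \<in> {0<..<d / R}"
    using d(1) R(1) by (intro eventually_at_right_real) auto
  then show ?thesis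
  proof eventually_elim
    case (elim r)
    have "norm z < d" if "scaled \<psi> r z \<noteq> 0" for z
    proof -
      have "norm (z /\<^sub>R r) \<le> R" using that by (intro R(2)) (auto simp: scaled_def)
      then have "norm z \<le> R * r" using elim by (simp add: field_simps)
      also have "\<dots> < d" using elim R(1) by (simp add: field_simps)
      finally show ?thesis .
    qed
    then show ?case using d(2) by blast
  qed
qed

lemma L2_norm_mollify_diff_tendsto:
  fixes f :: "'a::euclidean_space \<Rightarrow> 'b::euclidean_space" and w :: "'a \<Rightarrow> 'c::euclidean_space"
    and prod :: "'b \<Rightarrow> 'c \<Rightarrow> complex"
  assumes prod: "bounded_bilinear prod" and \<psi>: "friedrichs_mollifier \<psi>"
    and f: "f \<in> borel_measurable lebesgue" and w: "w \<in> borel_measurable lebesgue"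
    and int: "\<And>k x. test_function k \<Longrightarrow> integrable lebesgue (\<lambda>z. k z *\<^sub>R f (x - z))"
    and L2: "\<And>h. (\<lambda>x. prod (f (x - h) - f x) (w x)) \<in> L2"
    and lim: "((\<lambda>h. L2_norm (\<lambda>x. prod (f (x - h) - f x) (w x))) \<longlongrightarrow> 0) (at 0)"
  shows "((\<lambda>r. L2_norm (\<lambda>x. prod (convolve f (scaled \<psi> r) x - f x) (w x))) \<longlongrightarrow> 0) (at_right 0)"
proof (rule tendstoI)
  fix e :: real assume "0 < e"
  let ?D = "\<lambda>r. L2_norm (\<lambda>x. prod (convolve f (scaled \<psi> r) x - f x) (w x))"
  have "((\<lambda>h. L2_norm (\<lambda>x. prod (f (x - h) - f x) (w x))) \<longlongrightarrow> 0) (nhds 0)"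
    using lim by (simp add: tendsto_nhds_iff bounded_bilinear.zero_left[OF prod] L2_norm_def)
  from order_tendstoD(2)[OF this, of "e / 2"] \<open>0 < e\<close>
  have "\<forall>\<^sub>F h in nhds 0. L2_norm (\<lambda>x. prod (f (x - h) - f x) (w x)) < e / 2" by simp
  note eventually_scaled_support[OF mollifier_test_function[OF \<psi>] this]
  with eventually_at_right_less
  show "\<forall>\<^sub>F r in at_right 0. dist (?D r) 0 < e"
  proof eventually_elim
    case (elim r)
    note k = mollifier_scaled[OF \<psi> elim(1)]
    have "?D r \<le> e / 2"
      using elim(2) \<open>0 < e\<close>
      by (intro L2_norm_mollify_diff_le[OF prod k f w int[OF mollifier_test_function[OF k]]])
        (auto intro: L2 less_imp_le)
    then show ?case using \<open>0 < e\<close> by simp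
  qed
qed

lemma convolve_integrand_L2:
  assumes "test_function k" "f \<in> L2"
  shows "integrable lebesgue (\<lambda>z. k z *\<^sub>R f (x - z))"
  using test_function_scaleR_L2_integrable[OF assms(1) L2_affine[OF assms(2), of "-1" x]] by simp

lemma convolve_integrand_Linf:
  assumes "test_function k" "q \<in> Linf"
  shows "integrable lebesgue (\<lambda>z. k z *\<^sub>R q (x - z))"
  using integrable_scaleR_Linf[OF test_function_integrable[OF assms(1)]
      Linf_affine[OF assms(2), of "-1" x]]
  by simp

lemma L2_convolve:
  assumes k: "friedrichs_mollifier k" and f: "f \<in> L2"
  shows "convolve f k \<in> L2"
proof -
  note kt = mollifier_test_function[OF k]
  have "(\<lambda>x. 1 *\<^sub>R (convolve f k x - f x)) \<in> L2"
  proof (rule L2_mollify_diff[OF bounded_bilinear.flip[OF bounded_bilinear_scaleR] k,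
        where w = "\<lambda>_. 1"])
    show "(\<lambda>x. 1 *\<^sub>R (f (x - z) - f x)) \<in> L2 \<and>
        L2_norm (\<lambda>x. 1 *\<^sub>R (f (x - z) - f x)) \<le> L2_norm f + L2_norm f" for z
      using L2_norm_diff_le[OF L2_translate[OF f, of z] f] L2_diff[OF L2_translate[OF f, of z] f]
      by (simp add: L2_norm_translate)
  qed (use L2_measurable[OF f] convolve_integrand_L2[OF kt f] in simp_all)
  from L2_add[OF this f] show ?thesis by simp
qed

lemma mollify_L2_tendsto:
  assumes \<psi>: "friedrichs_mollifier \<psi>" and f: "f \<in> L2"
  shows "((\<lambda>r. L2_norm (\<lambda>x. convolve f (scaled \<psi> r) x - f x)) \<longlongrightarrow> 0) (at_right 0)"
  using L2_norm_mollify_diff_tendsto[OF bounded_bilinear.flip[OF bounded_bilinear_scaleR] \<psi>,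
      of f "\<lambda>_. 1"]
    L2_measurable[OF f] convolve_integrand_L2[OF _ f] L2_diff[OF L2_translate[OF f] f]
    L2_translate_tendsto[OF f]
  by simp

lemma mollify_Linf_scaleR_tendsto:
  assumes \<psi>: "friedrichs_mollifier \<psi>" and q: "q \<in> Linf" and u: "u \<in> L2"
  shows "((\<lambda>r. L2_norm (\<lambda>x. (convolve q (scaled \<psi> r) x - q x) *\<^sub>R u x)) \<longlongrightarrow> 0) (at_right 0)"
proof (rule L2_norm_mollify_diff_tendsto[OF bounded_bilinear_scaleR \<psi>])
  show "(\<lambda>x. (q (x - h) - q x) *\<^sub>R u x) \<in> L2" for h
    using Linf_affine[OF q, of 1 "- h"] by (intro Linf_scaleR_L2 Linf_diff q u) simp
qed (rule Linf_measurable[OF q] L2_measurable[OF u] convolve_integrand_Linf[OF _ q]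
    L2_translate_diff_scaleR_tendsto[OF q u]; assumption)+

lemma
  assumes k: "friedrichs_mollifier k" and q: "q \<in> Linf"
  shows Linf_convolve: "convolve q k \<in> Linf"
    and Linf_norm_convolve_le: "Linf_norm (convolve q k) \<le> Linf_norm q"
proof -
  note kt = mollifier_test_function[OF k]
  have "\<bar>convolve q k x\<bar> \<le> Linf_norm q" for x
  proof -
    have "AE z in lebesgue. norm (k z *\<^sub>R q (x - z)) \<le> Linf_norm q * k z"
      using AE_lebesgue_reflect[OF AE_abs_le_Linf_norm[OF q], of x]
    proof eventually_elim
      case (elim z)
      from mult_left_mono[OF this mollifier_nonneg[OF k, of z]] show ?case
        by (simp add: abs_mult mollifier_nonneg[OF k] mult.commute)
    qed
    then have "norm (convolve q k x) \<le> (LINT z|lebesgue. Linf_norm q * k z)"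
      unfolding convolve_eq_integral_translate
      using test_function_integrable[OF kt] convolve_integrand_Linf[OF kt q]
      by (intro order_trans[OF integral_norm_bound integral_mono_AE]) auto
    then show ?thesis by (simp add: mollifier_integral[OF k])
  qed
  then show "convolve q k \<in> Linf" "Linf_norm (convolve q k) \<le> Linf_norm q"
    using convolve_measurable[OF Linf_measurable[OF q] test_function_borel[OF kt]]
    by (auto intro: Linf_if_AE_le Linf_norm_le)
qed

section \<open>The Dirichlet form of the weak Laplacian\<close>

lemma inner_convolve:
  assumes "integrable lebesgue (\<lambda>z. k z *\<^sub>R g (x - z))"
  shows "w \<bullet> convolve g k x = (LINT z|lebesgue. k z * (w \<bullet> g (x - z)))"
  using integral_inner_right[OF assms, of w] by (simp add: convolve_eq_integral_translate)

lemma integrable_kernel_inner_translate: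
  fixes v g :: "'a::euclidean_space \<Rightarrow> complex"
  assumes [measurable]:
      "k \<in> borel_measurable borel" "v \<in> borel_measurable borel" "g \<in> borel_measurable borel"
    and k: "integrable lebesgue k" and v: "v \<in> L2" and g: "g \<in> L2"
  shows "integrable (lborel \<Otimes>\<^sub>M lborel) (\<lambda>(z, x). k z * (v x \<bullet> g (x - z)))"
proof (rule lborel_pair.Fubini_integrable)
  have "integrable lborel (\<lambda>x. v x \<bullet> g (x - z))" for z
    using L2_inner_integrable[OF v L2_translate[OF g, of z]] by (simp add: integrable_completion)
  then show "AE z in lborel. integrable lborel
      (\<lambda>x. case (z, x) of (z, x) \<Rightarrow> k z * (v x \<bullet> g (x - z)))"
    by simp
  have "(LINT x|lborel. \<bar>v x \<bullet> g (x - z)\<bar>) \<le> L2_norm v * L2_norm g" for z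
    using L2_integral_abs_inner_le[OF v L2_translate[OF g, of z]]
    by (simp add: integral_completion L2_norm_translate)
  then have bound: "\<bar>k z\<bar> * (LINT x|lborel. \<bar>v x \<bullet> g (x - z)\<bar>) \<le>
      \<bar>k z\<bar> * (L2_norm v * L2_norm g)" for z
    by (intro mult_left_mono) auto
  have "integrable lborel (\<lambda>z. \<bar>k z\<bar> * (L2_norm v * L2_norm g))"
    using k by (simp add: integrable_completion)
  then have "integrable lborel (\<lambda>z. \<bar>k z\<bar> * (LINT x|lborel. \<bar>v x \<bullet> g (x - z)\<bar>))"
    by (rule Bochner_Integration.integrable_bound) (use bound in \<open>auto simp: abs_mult\<close>)
  then show "integrable lborel
      (\<lambda>z. LINT x|lborel. norm (case (z, x) of (z, x) \<Rightarrow> k z * (v x \<bullet> g (x - z))))"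
    by (simp add: abs_mult)
qed measurable

lemma
  fixes v g :: "'a::euclidean_space \<Rightarrow> complex"
  assumes [measurable]: "k \<in> borel_measurable borel" and k: "integrable lebesgue k"
    and v: "v \<in> L2" and g: "g \<in> L2"
    and int: "\<And>x. integrable lebesgue (\<lambda>z. k z *\<^sub>R g (x - z))"
  shows integrable_inner_convolve: "integrable lebesgue (\<lambda>x. v x \<bullet> convolve g k x)"
    and L2_inner_convolve:
      "L2_inner v (convolve g k) = (LINT z|lebesgue. k z * L2_inner v (\<lambda>x. g (x - z)))"
proof -
  obtain v' where v': "v' \<in> borel_measurable borel" "AE x in lebesgue. v x = v' x"
    using ex_borel_version[OF L2_measurable[OF v]] .
  obtain g' where g': "g' \<in> borel_measurable borel" "AE x in lebesgue. g x = g' x"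
    using ex_borel_version[OF L2_measurable[OF g]] .
  note [measurable] = v'(1) g'(1)
  let ?F = "\<lambda>z x. k z * (v' x \<bullet> g' (x - z))"
  have "v' \<in> L2" "g' \<in> L2"
    using v g L2_cong_AE[OF v'(2)] L2_cong_AE[OF g'(2)] by simp_all
  then have F: "integrable (lborel \<Otimes>\<^sub>M lborel) (case_prod ?F)"
    by (intro integrable_kernel_inner_translate assms(1) v'(1) g'(1) k)
  have eq: "AE x in lebesgue. v x \<bullet> convolve g k x = (LINT z|lborel. ?F z x)"
    using v'(2)
  proof eventually_elim
    case (elim x)
    have "v x \<bullet> convolve g k x = (LINT z|lebesgue. k z * (v x \<bullet> g (x - z)))"
      by (rule inner_convolve[OF int])
    also have "\<dots> = (LINT z|lebesgue. ?F z x)"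
    proof (rule completion.integral_cong_AE)
      show "AE z in lebesgue. k z * (v x \<bullet> g (x - z)) = ?F z x"
        using AE_lebesgue_reflect[OF g'(2), of x] by eventually_elim (simp add: elim)
    qed
    also have "\<dots> = (LINT z|lborel. ?F z x)" by (rule integral_completion) measurable
    finally show ?case .
  qed
  show "integrable lebesgue (\<lambda>x. v x \<bullet> convolve g k x)"
    using lborel_pair.integrable_snd[OF F]
    by (simp add: completion.integrable_cong_AE[OF eq] integrable_completion)
  have "L2_inner v (convolve g k) = (LINT x|lborel. LINT z|lborel. ?F z x)"
    unfolding L2_inner_def by (simp add: completion.integral_cong_AE[OF eq] integral_completion)
  also have "\<dots> = (LINT z|lborel. k z * (LINT x|lborel. v' x \<bullet> g' (x - z)))"
    using lborel_pair.Fubini_integral[OF F] by simp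
  also have "\<dots> = (LINT z|lebesgue. k z * L2_inner v (\<lambda>x. g (x - z)))"
  proof -
    have "L2_inner v (\<lambda>x. g (x - z)) = (LINT x|lborel. v' x \<bullet> g' (x - z))" for z
      using L2_inner_cong_AE[OF v'(2) AE_lebesgue_translate[OF g'(2), of z]]
      by (simp add: L2_inner_def integral_completion)
    then show ?thesis by (simp add: integral_completion)
  qed
  finally show "L2_inner v (convolve g k) = (LINT z|lebesgue. k z * L2_inner v (\<lambda>x. g (x - z)))" .
qed

lemma L2_inner_convolve_adjoint:
  assumes k: "test_function k" and v: "v \<in> L2" and g: "g \<in> L2"
  shows "L2_inner v (convolve g k) = L2_inner g (convolve v (\<lambda>z. k (- z)))"
proof -
  note k' = test_function_reflect(2)[OF k]
  have "L2_inner v (\<lambda>x. g (x - z)) = L2_inner g (\<lambda>x. v (x + z))" for z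
    using integral_lebesgue_translate[of "\<lambda>x. v x \<bullet> g (x - z)" "- z"]
    by (simp add: L2_inner_def inner_commute)
  then have "L2_inner v (convolve g k) = (LINT z|lebesgue. k z * L2_inner g (\<lambda>x. v (x + z)))"
    using L2_inner_convolve[OF test_function_borel[OF k] test_function_integrable[OF k] v g
        convolve_integrand_L2[OF k g]] by simp
  also have "\<dots> = (LINT z|lebesgue. k (- z) * L2_inner g (\<lambda>x. v (x - z)))"
    using integral_lebesgue_affine[of "-1" "\<lambda>z. k z * L2_inner g (\<lambda>x. v (x + z))" 0] by simp
  also have "\<dots> = L2_inner g (convolve v (\<lambda>z. k (- z)))"
    using L2_inner_convolve[OF test_function_borel[OF k'] test_function_integrable[OF k'] g v
        convolve_integrand_L2[OF k' v]] by simp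
  finally show ?thesis .
qed

lemma convolve_uminus: "convolve f (\<lambda>z. - k z) x = - convolve f k x"
  by (simp add: convolve_def)

lemma convolve_weak_partial:
  assumes g: "has_weak_partial b f g" and k: "test_function k"
  shows "convolve g k = convolve f (partial b k)"
proof
  fix x
  have "(LINT y|lebesgue. partial b (\<lambda>y. k (x - y)) y *\<^sub>R f y) =
      - (LINT y|lebesgue. k (x - y) *\<^sub>R g y)"
    using g test_function_reflect(1)[OF k] unfolding has_weak_partial_def by blast
  then show "convolve g k x = convolve f (partial b k) x"
    by (simp add: partial_reflect(1)[OF k] convolve_def)
qed

lemma convolve_weak_laplacian:
  assumes g: "has_weak_laplacian f g" and k: "test_function k"
  shows "convolve g k = convolve f (laplacian k)"
proof
  fix x
  have "(LINT y|lebesgue. laplacian (\<lambda>y. k (x - y)) y *\<^sub>R f y) =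
      (LINT y|lebesgue. k (x - y) *\<^sub>R g y)"
    using g test_function_reflect(1)[OF k] unfolding has_weak_laplacian_def by blast
  then show "convolve g k x = convolve f (laplacian k) x"
    by (simp add: laplacian_reflect[OF k] convolve_def)
qed

lemma convolve_laplacian:
  assumes f: "f \<in> L2" and k: "test_function k"
  shows "convolve f (laplacian k) x = (\<Sum>b\<in>Basis. convolve f (partial b (partial b k)) x)"
  unfolding convolve_def laplacian_def scaleR_sum_left
  by (intro Bochner_Integration.integral_sum test_function_scaleR_L2_integrable f
      test_function_reflect test_function_partial k)

text \<open>
  All derivatives are moved onto the kernel, so no smoothness of the convolution, no cut-off and no
  density of test functions in \<open>H\<^sup>1\<close> is needed:
  \<open>L * k = v * \<Delta>k = \<Sum>\<^sub>b g\<^sub>b * \<partial>\<^sub>b k\<close>, and the adjoint carries the kernel \<open>\<partial>\<^sub>b k\<close> over to \<open>v\<close>.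
\<close>

lemma weak_green_identity_convolve:
  fixes v :: "'a::euclidean_space \<Rightarrow> complex"
  assumes k: "test_function k" and L: "has_weak_laplacian v L"
    and g: "\<And>b. b \<in> Basis \<Longrightarrow> has_weak_partial b v (g b)"
  shows "L2_inner v (convolve L k) = - (\<Sum>b\<in>Basis. L2_inner (g b) (convolve (g b) (\<lambda>z. k (- z))))"
proof -
  have v: "v \<in> L2" using L by (simp add: has_weak_laplacian_def)
  have gL2: "g b \<in> L2" if "b \<in> Basis" for b using g[OF that] by (simp add: has_weak_partial_def)
  have "convolve L k x = (\<Sum>b\<in>Basis. convolve (g b) (partial b k) x)" for x
    using convolve_weak_partial[OF g test_function_partial[OF k]]
    by (simp add: convolve_weak_laplacian[OF L k] convolve_laplacian[OF v k])
  then have "L2_inner v (convolve L k) =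
      (LINT x|lebesgue. (\<Sum>b\<in>Basis. v x \<bullet> convolve (g b) (partial b k) x))"
    by (simp add: L2_inner_def inner_sum_right)
  also have "\<dots> = (\<Sum>b\<in>Basis. L2_inner v (convolve (g b) (partial b k)))"
    unfolding L2_inner_def
    by (intro Bochner_Integration.integral_sum integrable_inner_convolve test_function_borel
        test_function_integrable convolve_integrand_L2 test_function_partial k v gL2)
  also have "\<dots> = (\<Sum>b\<in>Basis. - L2_inner (g b) (convolve (g b) (\<lambda>z. k (- z))))"
  proof (rule sum.cong[OF refl])
    fix b :: 'a assume b: "b \<in> Basis"
    have "convolve v (\<lambda>z. partial b k (- z)) = (\<lambda>x. - convolve (g b) (\<lambda>z. k (- z)) x)"
      unfolding convolve_weak_partial[OF g[OF b] test_function_reflect(2)[OF k]]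
      by (simp add: fun_eq_iff partial_reflect(2)[OF k] convolve_uminus)
    then show "L2_inner v (convolve (g b) (partial b k)) =
        - L2_inner (g b) (convolve (g b) (\<lambda>z. k (- z)))"
      unfolding L2_inner_convolve_adjoint[OF test_function_partial[OF k b] v gL2[OF b]]
      by (simp add: L2_inner_def)
  qed
  finally show ?thesis by (simp add: sum_negf)
qed

lemma L2_inner_mollify_tendsto:
  assumes \<psi>: "friedrichs_mollifier \<psi>" and f: "f \<in> L2" and g: "g \<in> L2"
  shows "((\<lambda>r. L2_inner g (convolve f (scaled \<psi> r))) \<longlongrightarrow> L2_inner g f) (at_right 0)"
proof (rule L2_inner_tendsto)
  show "\<forall>\<^sub>F r in at_right 0. convolve f (scaled \<psi> r) \<in> L2"
    using eventually_at_right_less by eventually_elim (intro L2_convolve mollifier_scaled \<psi> f)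
qed (use f g mollify_L2_tendsto[OF \<psi> f] in \<open>simp_all add: L2_norm_def\<close>)

lemma weak_green_identity:
  fixes v :: "'a::euclidean_space \<Rightarrow> complex" and \<psi> :: "'a \<Rightarrow> real"
  assumes \<psi>: "friedrichs_mollifier \<psi>" and L: "has_weak_laplacian v L"
    and g: "\<And>b. b \<in> Basis \<Longrightarrow> has_weak_partial b v (g b)"
  shows "L2_inner v L = - (\<Sum>b\<in>Basis. (L2_norm (g b))\<^sup>2)"
proof -
  let ?\<psi> = "\<lambda>x. \<psi> (- x)"
  let ?D = "\<lambda>r. - (\<Sum>b\<in>Basis. L2_inner (g b) (convolve (g b) (scaled ?\<psi> r)))"
  have "((\<lambda>r. L2_inner v (convolve L (scaled \<psi> r))) \<longlongrightarrow> L2_inner v L) (at_right 0)"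
    using L by (intro L2_inner_mollify_tendsto \<psi>) (simp_all add: has_weak_laplacian_def)
  moreover have "\<forall>\<^sub>F r in at_right 0. L2_inner v (convolve L (scaled \<psi> r)) = ?D r"
    using eventually_at_right_less
  proof eventually_elim
    case (elim r)
    have "(\<lambda>z. scaled \<psi> r (- z)) = scaled ?\<psi> r" by (simp add: scaled_def fun_eq_iff)
    with weak_green_identity_convolve[OF
        mollifier_test_function[OF mollifier_scaled[OF \<psi> elim]] L g]
    show ?case by simp
  qed
  ultimately have "(?D \<longlongrightarrow> L2_inner v L) (at_right 0)"
    by (rule Lim_transform_eventually)
  moreover have "(?D \<longlongrightarrow> - (\<Sum>b\<in>Basis. L2_inner (g b) (g b))) (at_right 0)"
    using g by (intro tendsto_minus tendsto_sum L2_inner_mollify_tendsto mollifier_reflect \<psi>)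
      (simp_all add: has_weak_partial_def)
  ultimately show ?thesis
    using tendsto_unique[OF trivial_limit_at_right_real] by (simp add: L2_norm_square)
qed

lemma weak_laplacian_dissipative:
  fixes v :: "'a::euclidean_space \<Rightarrow> complex" and \<psi> :: "'a \<Rightarrow> real"
  assumes \<psi>: "friedrichs_mollifier \<psi>" and L: "has_weak_laplacian v L" and v: "v \<in> H1"
  shows "L2_inner v L \<le> 0"
proof -
  obtain g where "\<And>b. b \<in> Basis \<Longrightarrow> has_weak_partial b v (g b)"
    using v unfolding H1_def by (simp add: bchoice_iff) blast
  from weak_green_identity[OF \<psi> L this] show ?thesis by (simp add: sum_nonneg)
qed

lemma H1_L2: "f \<in> H1 \<Longrightarrow> f \<in> L2"
  by (simp add: H1_def)

lemma has_weak_partial_diff: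
  assumes "has_weak_partial b f f'" "has_weak_partial b g g'" "b \<in> Basis"
  shows "has_weak_partial b (\<lambda>x. f x - g x) (\<lambda>x. f' x - g' x)"
proof -
  have L2: "f \<in> L2" "f' \<in> L2" "g \<in> L2" "g' \<in> L2"
    using assms by (auto simp: has_weak_partial_def)
  show ?thesis
    unfolding has_weak_partial_def
  proof (intro conjI L2_diff L2 allI impI)
    fix \<phi> :: "'a \<Rightarrow> real" assume \<phi>: "test_function \<phi>"
    note int = test_function_scaleR_L2_integrable[OF \<phi>]
      test_function_scaleR_L2_integrable[OF test_function_partial[OF \<phi> assms(3)]]
    show "(LINT x|lebesgue. partial b \<phi> x *\<^sub>R (f x - g x)) =
        - (LINT x|lebesgue. \<phi> x *\<^sub>R (f' x - g' x))"
      using assms(1,2) \<phi> int L2 by (simp add: has_weak_partial_def scaleR_diff_right)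
  qed
qed

lemma H1_diff:
  assumes "f \<in> H1" "g \<in> H1"
  shows "(\<lambda>x. f x - g x) \<in> H1"
proof -
  have "\<exists>h. has_weak_partial b (\<lambda>x. f x - g x) h" if "b \<in> Basis" for b
    using assms that has_weak_partial_diff[of b f _ g] unfolding H1_def by blast
  with assms show ?thesis by (simp add: H1_def L2_diff)
qed

lemma has_weak_laplacian_cong_AE:
  assumes "AE x in lebesgue. g x = h x"
  shows "has_weak_laplacian f g \<longleftrightarrow> has_weak_laplacian f h"
proof -
  have "(LINT x|lebesgue. \<phi> x *\<^sub>R g x) = (LINT x|lebesgue. \<phi> x *\<^sub>R h x)" for \<phi> :: "'a \<Rightarrow> real"
    by (rule completion.integral_cong_AE) (use assms in \<open>auto elim: eventually_mono\<close>)
  then show ?thesis unfolding has_weak_laplacian_def L2_cong_AE[OF assms] by simp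
qed

lemma has_weak_laplacian_diff:
  assumes "has_weak_laplacian f f'" "has_weak_laplacian g g'"
  shows "has_weak_laplacian (\<lambda>x. f x - g x) (\<lambda>x. f' x - g' x)"
proof -
  have L2: "f \<in> L2" "f' \<in> L2" "g \<in> L2" "g' \<in> L2"
    using assms by (auto simp: has_weak_laplacian_def)
  show ?thesis
    unfolding has_weak_laplacian_def
  proof (intro conjI L2_diff L2 allI impI)
    fix \<phi> :: "'a \<Rightarrow> real" assume \<phi>: "test_function \<phi>"
    have "integrable lebesgue (\<lambda>x. laplacian \<phi> x *\<^sub>R h x)" if "h \<in> L2" for h
      unfolding laplacian_def scaleR_sum_left
      by (intro Bochner_Integration.integrable_sum test_function_scaleR_L2_integrable
          test_function_partial \<phi> that)
    then show "(LINT x|lebesgue. laplacian \<phi> x *\<^sub>R (f x - g x)) =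
        (LINT x|lebesgue. \<phi> x *\<^sub>R (f' x - g' x))"
      using assms \<phi> test_function_scaleR_L2_integrable[OF \<phi>] L2
      by (simp add: has_weak_laplacian_def scaleR_diff_right)
  qed
qed

section \<open>The energy estimate\<close>

definition has_L2_derivative ::
  "(real \<Rightarrow> 'a::euclidean_space \<Rightarrow> complex) \<Rightarrow> ('a \<Rightarrow> complex) \<Rightarrow> real \<Rightarrow> real set \<Rightarrow> bool" where
  "has_L2_derivative v v' t S \<longleftrightarrow>
     ((\<lambda>s. L2_norm (\<lambda>x. (v s x - v t x) /\<^sub>R (s - t) - v' x)) \<longlongrightarrow> 0) (at t within S)"

lemma has_L2_derivative_diff:
  assumes v: "\<And>s. s \<in> S \<Longrightarrow> v s \<in> L2" "v' \<in> L2" "has_L2_derivative v v' t S"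
    and w: "\<And>s. s \<in> S \<Longrightarrow> w s \<in> L2" "w' \<in> L2" "has_L2_derivative w w' t S" and "t \<in> S"
  shows "has_L2_derivative (\<lambda>s x. v s x - w s x) (\<lambda>x. v' x - w' x) t S"
  unfolding has_L2_derivative_def
proof (rule Lim_null_comparison)
  let ?dv = "\<lambda>s x. (v s x - v t x) /\<^sub>R (s - t) - v' x"
  let ?dw = "\<lambda>s x. (w s x - w t x) /\<^sub>R (s - t) - w' x"
  let ?d = "\<lambda>s x. ((v s x - w s x) - (v t x - w t x)) /\<^sub>R (s - t) - (v' x - w' x)"
  show "((\<lambda>s. L2_norm (?dv s) + L2_norm (?dw s)) \<longlongrightarrow> 0) (at t within S)"
    using v(3) w(3) unfolding has_L2_derivative_def by (rule tendsto_add_zero)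
  have "norm (L2_norm (?d s)) \<le> L2_norm (?dv s) + L2_norm (?dw s)" if "s \<in> S" for s
  proof -
    have "?d s = (\<lambda>x. ?dv s x - ?dw s x)"
      by (simp add: fun_eq_iff algebra_simps)
    moreover have "?dv s \<in> L2" "?dw s \<in> L2"
      using that \<open>t \<in> S\<close> by (auto intro!: L2_diff L2_scaleR v w)
    ultimately show ?thesis by (simp add: L2_norm_diff_le)
  qed
  then show "\<forall>\<^sub>F s in at t within S. norm (L2_norm (?d s)) \<le> L2_norm (?dv s) + L2_norm (?dw s)"
    by (simp add: eventually_at_filter)
qed

lemma L2_norm_square_has_derivative:
  assumes v: "\<And>s. s \<in> S \<Longrightarrow> v s \<in> L2" and v': "v' \<in> L2" and deriv: "has_L2_derivative v v' t S"
    and "t \<in> S"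
  shows "((\<lambda>s. (L2_norm (v s))\<^sup>2) has_real_derivative 2 * L2_inner (v t) v') (at t within S)"
proof -
  define dv where "dv s x = (v s x - v t x) /\<^sub>R (s - t)" for s x
  have dv: "dv s \<in> L2" if "s \<in> S" for s
    unfolding dv_def by (intro L2_scaleR L2_diff v that \<open>t \<in> S\<close>)
  have "((L2_norm (v s))\<^sup>2 - (L2_norm (v t))\<^sup>2) / (s - t) =
      2 * L2_inner (v t) (dv s) + (s - t) * L2_inner (dv s) (dv s)" if "s \<in> S" "s \<noteq> t" for s
  proof -
    have "v s = (\<lambda>x. v t x + (s - t) *\<^sub>R dv s x)" using that(2) by (simp add: dv_def fun_eq_iff)
    then have "(L2_norm (v s))\<^sup>2 = (L2_norm (v t))\<^sup>2 +
        2 * ((s - t) * L2_inner (v t) (dv s)) + (s - t)\<^sup>2 * L2_inner (dv s) (dv s)"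
      using L2_norm_add_square[OF v[OF \<open>t \<in> S\<close>] L2_scaleR[OF dv[OF that(1)], of "s - t"]]
      by (simp add: L2_inner_scaleR_right L2_norm_scaleR power_mult_distrib
          L2_norm_square[of "dv s"])
    then show ?thesis using that(2) by (simp add: field_simps power2_eq_square)
  qed
  then have quotient: "\<forall>\<^sub>F s in at t within S.
      2 * L2_inner (v t) (dv s) + (s - t) * L2_inner (dv s) (dv s) =
      ((L2_norm (v s))\<^sup>2 - (L2_norm (v t))\<^sup>2) / (s - t)"
    by (simp add: eventually_at_filter)
  have dv_ev: "\<forall>\<^sub>F s in at t within S. dv s \<in> L2"
    using dv by (simp add: eventually_at_filter)
  have dv_lim: "((\<lambda>s. L2_norm (\<lambda>x. dv s x - v' x)) \<longlongrightarrow> 0) (at t within S)"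
    using deriv by (simp add: has_L2_derivative_def dv_def)
  have "((\<lambda>s. 2 * L2_inner (v t) (dv s) + (s - t) * L2_inner (dv s) (dv s)) \<longlongrightarrow>
      2 * L2_inner (v t) v' + (t - t) * L2_inner v' v') (at t within S)"
    using v[OF \<open>t \<in> S\<close>] v' dv_ev dv_lim
    by (intro tendsto_intros L2_inner_tendsto) (simp_all add: L2_norm_def)
  then show ?thesis
    unfolding has_field_derivative_iff using Lim_transform_eventually[OF _ quotient] by simp
qed

lemma sqrt_growth_le:
  fixes N N' :: "real \<Rightarrow> real"
  assumes deriv: "\<And>s. s \<in> {0..T} \<Longrightarrow> (N has_real_derivative N' s) (at s within {0..T})"
    and nonneg: "\<And>s. s \<in> {0..T} \<Longrightarrow> 0 \<le> N s"
    and growth: "\<And>s. s \<in> {0..T} \<Longrightarrow> N' s \<le> 2 * \<delta> * sqrt (N s)"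
    and "0 \<le> \<delta>" and t: "t \<in> {0..T}"
  shows "sqrt (N t) \<le> sqrt (N 0) + \<delta> * t"
proof (rule field_le_epsilon)
  fix e :: real assume "0 < e"
  define M where "M s = sqrt (N s + e\<^sup>2) - \<delta> * s" for s
  have pos: "0 < N s + e\<^sup>2" if "s \<in> {0..T}" for s
    using nonneg[OF that] \<open>0 < e\<close> by (simp add: add_nonneg_pos)
  have M: "(M has_real_derivative N' s / (2 * sqrt (N s + e\<^sup>2)) - \<delta>) (at s within {0..T})"
    if "s \<in> {0..T}" for s
    unfolding M_def using pos[OF that]
    by (auto intro!: derivative_eq_intros deriv that simp: divide_simps)
  have "M t \<le> M 0"
  proof (rule DERIV_nonpos_imp_decreasing_open[of 0 t M])
    show "0 \<le> t" using t by simp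
    have "continuous_on {0..T} M" using M by (rule DERIV_continuous_on)
    then show "continuous_on {0..t} M" by (rule continuous_on_subset) (use t in auto)
    fix s assume s: "0 < s" "s < t"
    then have "s \<in> {0..T}" using t by simp
    have "N' s \<le> 2 * \<delta> * sqrt (N s)" using growth \<open>s \<in> {0..T}\<close> .
    also have "\<dots> \<le> \<delta> * (2 * sqrt (N s + e\<^sup>2))"
      using \<open>0 \<le> \<delta>\<close> by (simp add: mult_left_mono)
    finally have "N' s / (2 * sqrt (N s + e\<^sup>2)) - \<delta> \<le> 0"
      using pos[OF \<open>s \<in> {0..T}\<close>] by (simp add: divide_le_eq)
    moreover have "(M has_real_derivative N' s / (2 * sqrt (N s + e\<^sup>2)) - \<delta>) (at s)"
      using M[OF \<open>s \<in> {0..T}\<close>] s t by (simp add: at_within_Icc_at)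
    ultimately show "\<exists>y. (M has_real_derivative y) (at s) \<and> y \<le> 0" by blast
  qed
  then have "sqrt (N t + e\<^sup>2) \<le> sqrt (N 0 + e\<^sup>2) + \<delta> * t" by (simp add: M_def)
  also have "sqrt (N 0 + e\<^sup>2) \<le> sqrt (N 0) + e"
    using sqrt_add_le_add_sqrt[of "N 0" "e\<^sup>2"] nonneg[of 0] t \<open>0 < e\<close> by simp
  finally have "sqrt (N t + e\<^sup>2) \<le> sqrt (N 0) + \<delta> * t + e" by simp
  then show "sqrt (N t) \<le> sqrt (N 0) + \<delta> * t + e"
    by (rule order_trans[rotated]) simp
qed

lemma heat_energy_production_le:
  fixes v :: "'a::euclidean_space \<Rightarrow> complex" and \<psi> :: "'a \<Rightarrow> real"
  assumes \<psi>: "friedrichs_mollifier \<psi>" and p: "p \<in> Linf" "AE x in lebesgue. 0 \<le> p x"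
    and v: "v \<in> H1" and v': "v' \<in> L2" and r: "r \<in> L2"
    and L: "has_weak_laplacian v (\<lambda>x. v' x + p x *\<^sub>R v x + r x)"
  shows "L2_inner v v' \<le> L2_norm v * L2_norm r"
proof -
  note vL2 = H1_L2[OF v]
  note pv = Linf_scaleR_L2[OF p(1) vL2]
  have "0 \<le> L2_inner v (\<lambda>x. p x *\<^sub>R v x)"
    unfolding L2_inner_def
    by (rule integral_nonneg_AE) (use p(2) in \<open>auto elim: eventually_mono\<close>)
  moreover have "- L2_inner v r \<le> L2_norm v * L2_norm r"
    using L2_inner_bound[OF vL2 r] by simp
  moreover have "L2_inner v v' + L2_inner v (\<lambda>x. p x *\<^sub>R v x) + L2_inner v r \<le> 0"
    using weak_laplacian_dissipative[OF \<psi> L v] vL2 v' pv r by (simp add: L2_inner_add_right L2_add)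
  ultimately show ?thesis by simp
qed

lemma heat_energy_estimate:
  fixes v :: "real \<Rightarrow> 'a::euclidean_space \<Rightarrow> complex" and \<psi> :: "'a \<Rightarrow> real"
  assumes \<psi>: "friedrichs_mollifier \<psi>" and p: "p \<in> Linf" "AE x in lebesgue. 0 \<le> p x"
    and v: "\<And>s. s \<in> {0..T} \<Longrightarrow> v s \<in> H1" and v': "\<And>s. s \<in> {0..T} \<Longrightarrow> v' s \<in> L2"
    and deriv: "\<And>s. s \<in> {0..T} \<Longrightarrow> has_L2_derivative v (v' s) s {0..T}"
    and L: "\<And>s. s \<in> {0..T} \<Longrightarrow> has_weak_laplacian (v s) (\<lambda>x. v' s x + p x *\<^sub>R v s x + r s x)"
    and r: "\<And>s. s \<in> {0..T} \<Longrightarrow> r s \<in> L2" "\<And>s. s \<in> {0..T} \<Longrightarrow> L2_norm (r s) \<le> \<delta>"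
    and t: "t \<in> {0..T}"
  shows "L2_norm (v t) \<le> L2_norm (v 0) + \<delta> * t"
proof -
  have "sqrt ((L2_norm (v t))\<^sup>2) \<le> sqrt ((L2_norm (v 0))\<^sup>2) + \<delta> * t"
  proof (rule sqrt_growth_le[OF _ _ _ _ t])
    fix s assume s: "s \<in> {0..T}"
    show "((\<lambda>s. (L2_norm (v s))\<^sup>2) has_real_derivative 2 * L2_inner (v s) (v' s))
        (at s within {0..T})"
      by (intro L2_norm_square_has_derivative H1_L2 v v' deriv s)
    have "L2_inner (v s) (v' s) \<le> L2_norm (v s) * L2_norm (r s)"
      by (rule heat_energy_production_le[OF \<psi> p v v' r(1) L]) (rule s)+
    also have "\<dots> \<le> L2_norm (v s) * \<delta>"
      using r(2)[OF s] by (intro mult_left_mono) auto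
    finally show "2 * L2_inner (v s) (v' s) \<le> 2 * \<delta> * sqrt ((L2_norm (v s))\<^sup>2)"
      by (simp add: mult.commute)
  qed (use order_trans[OF L2_norm_nonneg r(2)[OF t]] in simp_all)
  then show ?thesis by simp
qed

section \<open>Stability of classical solutions\<close>

lemma classical_solutionE:
  assumes u: "classical_solution T q u0 u"
  obtains u' where "\<And>s. s \<in> {0..T} \<Longrightarrow> u s \<in> H1" "\<And>s. s \<in> {0..T} \<Longrightarrow> u' s \<in> L2"
    "\<And>s. s \<in> {0..T} \<Longrightarrow> has_L2_derivative u (u' s) s {0..T}"
    "\<And>s. s \<in> {0..T} \<Longrightarrow> has_weak_laplacian (u s) (\<lambda>x. u' s x + q x *\<^sub>R u s x)"
proof -
  obtain u' where u': "has_C1_L2_deriv T u u'"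
    and eq: "\<And>s. s \<in> {0..T} \<Longrightarrow> \<exists>Lu. has_weak_laplacian (u s) Lu \<and>
      (AE x in lebesgue. u' s x - Lu x + q x *\<^sub>R u s x = 0)"
    using u by (auto simp: classical_solution_def)
  show thesis
  proof
    fix s assume s: "s \<in> {0..T}"
    show "u s \<in> H1" using u s by (simp add: classical_solution_def C_into_def)
    show "u' s \<in> L2" "has_L2_derivative u (u' s) s {0..T}"
      using u' s by (simp_all add: has_C1_L2_deriv_def C_into_def has_L2_derivative_def)
    obtain Lu where Lu: "has_weak_laplacian (u s) Lu"
      "AE x in lebesgue. u' s x - Lu x + q x *\<^sub>R u s x = 0"
      using eq[OF s] by blast
    have "AE x in lebesgue. Lu x = u' s x + q x *\<^sub>R u s x"
      using Lu(2) by eventually_elim (simp add: algebra_simps)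
    from has_weak_laplacian_cong_AE[OF this] Lu(1)
    show "has_weak_laplacian (u s) (\<lambda>x. u' s x + q x *\<^sub>R u s x)" by simp
  qed
qed

lemma classical_solution_stability:
  fixes u w :: "real \<Rightarrow> 'a::euclidean_space \<Rightarrow> complex" and \<psi> :: "'a \<Rightarrow> real"
  assumes \<psi>: "friedrichs_mollifier \<psi>"
    and u: "classical_solution T q u0 u" and w: "classical_solution T p w0 w"
    and p: "p \<in> Linf" "AE x in lebesgue. 0 \<le> p x" and q: "q \<in> Linf"
    and \<delta>: "\<And>s. s \<in> {0..T} \<Longrightarrow> L2_norm (\<lambda>x. (p x - q x) *\<^sub>R u s x) \<le> \<delta>"
    and t: "t \<in> {0..T}"
  shows "L2_norm (\<lambda>x. w t x - u t x) \<le> L2_norm (\<lambda>x. w0 x - u0 x) + \<delta> * t"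
proof -
  obtain u' where u': "\<And>s. s \<in> {0..T} \<Longrightarrow> u s \<in> H1" "\<And>s. s \<in> {0..T} \<Longrightarrow> u' s \<in> L2"
    "\<And>s. s \<in> {0..T} \<Longrightarrow> has_L2_derivative u (u' s) s {0..T}"
    "\<And>s. s \<in> {0..T} \<Longrightarrow> has_weak_laplacian (u s) (\<lambda>x. u' s x + q x *\<^sub>R u s x)"
    using classical_solutionE[OF u] by blast
  obtain w' where w': "\<And>s. s \<in> {0..T} \<Longrightarrow> w s \<in> H1" "\<And>s. s \<in> {0..T} \<Longrightarrow> w' s \<in> L2"
    "\<And>s. s \<in> {0..T} \<Longrightarrow> has_L2_derivative w (w' s) s {0..T}"
    "\<And>s. s \<in> {0..T} \<Longrightarrow> has_weak_laplacian (w s) (\<lambda>x. w' s x + p x *\<^sub>R w s x)"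
    using classical_solutionE[OF w] by blast
  have "L2_norm (\<lambda>x. w t x - u t x) \<le> L2_norm (\<lambda>x. w 0 x - u 0 x) + \<delta> * t"
  proof (rule heat_energy_estimate[OF \<psi> p _ _ _ _ _ _ t])
    fix s assume s: "s \<in> {0..T}"
    show "(\<lambda>x. w s x - u s x) \<in> H1" by (intro H1_diff u' w' s)
    show "(\<lambda>x. w' s x - u' s x) \<in> L2" by (intro L2_diff u' w' s)
    show "has_L2_derivative (\<lambda>s x. w s x - u s x) (\<lambda>x. w' s x - u' s x) s {0..T}"
      by (intro has_L2_derivative_diff H1_L2 u' w' s)
    show "(\<lambda>x. (p x - q x) *\<^sub>R u s x) \<in> L2"
      by (intro Linf_scaleR_L2 Linf_diff p q H1_L2 u' s)
    show "has_weak_laplacian (\<lambda>x. w s x - u s x)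
        (\<lambda>x. (w' s x - u' s x) + p x *\<^sub>R (w s x - u s x) + (p x - q x) *\<^sub>R u s x)"
      using has_weak_laplacian_diff[OF w'(4)[OF s] u'(4)[OF s]] by (simp add: algebra_simps)
  qed (rule \<delta>)
  moreover have "AE x in lebesgue. w 0 x = w0 x" "AE x in lebesgue. u 0 x = u0 x"
    using u w by (simp_all add: classical_solution_def)
  then have "AE x in lebesgue. w 0 x - u 0 x = w0 x - u0 x" by eventually_elim simp
  ultimately show ?thesis by (simp add: L2_norm_cong_AE)
qed

lemma classical_solution_tendsto:
  fixes u :: "real \<Rightarrow> 'a::euclidean_space \<Rightarrow> complex" and \<psi> :: "'a \<Rightarrow> real"
  assumes \<psi>: "friedrichs_mollifier \<psi>" and u: "classical_solution T q u0 u" and q: "q \<in> Linf"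
    and w: "\<forall>\<^sub>F n in F. classical_solution T (p n) (w0 n) (w n) \<and>
      p n \<in> Linf \<and> (AE x in lebesgue. 0 \<le> p n x)"
    and init: "((\<lambda>n. L2_norm (\<lambda>x. w0 n x - u0 x)) \<longlongrightarrow> 0) F"
    and potential: "uniform_limit {0..T} (\<lambda>n s. L2_norm (\<lambda>x. (p n x - q x) *\<^sub>R u s x)) (\<lambda>_. 0) F"
    and t: "t \<in> {0..T}"
  shows "((\<lambda>n. L2_norm (\<lambda>x. w n t x - u t x)) \<longlongrightarrow> 0) F"
proof (rule tendstoI)
  fix e :: real assume "0 < e"
  define \<delta> where "\<delta> = e / (2 * (t + 1))"
  have \<delta>: "0 < \<delta>" "\<delta> * t < e / 2" using \<open>0 < e\<close> t by (auto simp: \<delta>_def field_simps)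
  have "\<forall>\<^sub>F n in F. L2_norm (\<lambda>x. w0 n x - u0 x) < e / 2"
    using order_tendstoD(2)[OF init, of "e / 2"] \<open>0 < e\<close> by simp
  with w uniform_limitD[OF potential \<delta>(1)]
  show "\<forall>\<^sub>F n in F. dist (L2_norm (\<lambda>x. w n t x - u t x)) 0 < e"
  proof eventually_elim
    case (elim n)
    then have "L2_norm (\<lambda>x. w n t x - u t x) \<le> L2_norm (\<lambda>x. w0 n x - u0 x) + \<delta> * t"
      by (intro classical_solution_stability[OF \<psi> u _ _ _ q _ t]) (auto intro: less_imp_le)
    with elim(3) \<delta>(2) show ?case by simp
  qed
qed

section \<open>Regularising families\<close>

lemma uniform_limit_compact_equicontinuous:
  fixes f :: "'n \<Rightarrow> 'a::metric_space \<Rightarrow> 'b::metric_space"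
  assumes S: "compact S"
    and equi: "\<And>x e. x \<in> S \<Longrightarrow> 0 < e \<Longrightarrow>
      \<exists>d>0. \<forall>\<^sub>F n in F. \<forall>y\<in>S. dist x y < d \<longrightarrow> dist (f n x) (f n y) < e"
    and lim: "\<And>x. x \<in> S \<Longrightarrow> ((\<lambda>n. f n x) \<longlongrightarrow> l x) F"
    and "F \<noteq> bot"
  shows "uniform_limit S f l F"
proof (rule uniform_limitI)
  fix e :: real assume "0 < e"
  then have "\<forall>x\<in>S. \<exists>d>0. \<forall>\<^sub>F n in F. \<forall>y\<in>S. dist x y < d \<longrightarrow> dist (f n x) (f n y) < e / 4"
    using equi[of _ "e / 4"] by simp
  from bchoice[OF this] obtain d where d: "\<And>x. x \<in> S \<Longrightarrow> 0 < d x"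
    "\<And>x. x \<in> S \<Longrightarrow> \<forall>\<^sub>F n in F. \<forall>y\<in>S. dist x y < d x \<longrightarrow> dist (f n x) (f n y) < e / 4"
    by blast
  have dist_l: "dist (l x) (l y) \<le> e / 4" if "x \<in> S" "y \<in> S" "dist x y < d x" for x y
  proof (rule tendsto_upperbound[OF tendsto_dist[OF lim lim] _ \<open>F \<noteq> bot\<close>])
    show "\<forall>\<^sub>F n in F. dist (f n x) (f n y) \<le> e / 4"
      using d(2)[OF that(1)] by eventually_elim (use that in auto)
  qed fact+
  obtain D where D: "D \<subseteq> S" "finite D" "S \<subseteq> (\<Union>x\<in>D. ball x (d x))"
  proof (rule compactE_image[OF S, of S "\<lambda>x. ball x (d x)"])
    show "S \<subseteq> (\<Union>x\<in>S. ball x (d x))" using d(1) by force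
  qed auto
  have "\<forall>\<^sub>F n in F. \<forall>x\<in>D. dist (f n x) (l x) < e / 4 \<and>
      (\<forall>y\<in>S. dist x y < d x \<longrightarrow> dist (f n x) (f n y) < e / 4)"
  proof (rule eventually_ball_finite[OF D(2)], rule ballI)
    fix x assume "x \<in> D"
    then have "x \<in> S" using D(1) by blast
    then show "\<forall>\<^sub>F n in F. dist (f n x) (l x) < e / 4 \<and>
        (\<forall>y\<in>S. dist x y < d x \<longrightarrow> dist (f n x) (f n y) < e / 4)"
      using \<open>0 < e\<close> by (intro eventually_conj tendstoD lim d(2)) auto
  qed
  then show "\<forall>\<^sub>F n in F. \<forall>y\<in>S. dist (f n y) (l y) < e"
  proof eventually_elim
    case (elim n)
    show ?case
    proof
      fix y assume y: "y \<in> S"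
      then obtain x where x: "x \<in> D" "dist x y < d x" using D(3) by auto
      have "dist (f n y) (l y) \<le> dist (f n x) (f n y) + dist (f n x) (l x) + dist (l x) (l y)"
        by metric
      moreover have "dist (f n x) (f n y) < e / 4" "dist (f n x) (l x) < e / 4"
        using elim x y by auto
      moreover have "dist (l x) (l y) \<le> e / 4" using D(1) x y by (intro dist_l) auto
      ultimately show "dist (f n y) (l y) < e" using \<open>0 < e\<close> by linarith
    qed
  qed
qed

lemma mollify_Linf_scaleR_lipschitz:
  assumes k: "friedrichs_mollifier k" and q: "q \<in> Linf" and u: "u \<in> L2" and w: "w \<in> L2"
  shows "\<bar>L2_norm (\<lambda>x. (convolve q k x - q x) *\<^sub>R u x) -
    L2_norm (\<lambda>x. (convolve q k x - q x) *\<^sub>R w x)\<bar> \<le> 2 * Linf_norm q * L2_norm (\<lambda>x. u x - w x)"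
proof -
  let ?p = "\<lambda>x. convolve q k x - q x"
  note p = Linf_diff[OF Linf_convolve[OF k q] q]
  have "\<bar>L2_norm (\<lambda>x. ?p x *\<^sub>R u x) - L2_norm (\<lambda>x. ?p x *\<^sub>R w x)\<bar> \<le>
      L2_norm (\<lambda>x. ?p x *\<^sub>R (u x - w x))"
    using L2_norm_triangle_diff[OF Linf_scaleR_L2[OF p u] Linf_scaleR_L2[OF p w]]
    by (simp add: scaleR_diff_right)
  also have "\<dots> \<le> Linf_norm ?p * L2_norm (\<lambda>x. u x - w x)"
    by (intro L2_norm_Linf_scaleR_le p L2_diff u w)
  also have "\<dots> \<le> 2 * Linf_norm q * L2_norm (\<lambda>x. u x - w x)"
    using Linf_norm_diff_le[OF Linf_convolve[OF k q] q] Linf_norm_convolve_le[OF k q]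
    by (intro mult_right_mono) simp_all
  finally show ?thesis .
qed

lemma mollify_Linf_scaleR_uniform_limit:
  assumes \<psi>: "friedrichs_mollifier \<psi>" and q: "q \<in> Linf" and u: "u \<in> C_into T L2 L2_norm"
  shows "uniform_limit {0..T} (\<lambda>r s. L2_norm (\<lambda>x. (convolve q (scaled \<psi> r) x - q x) *\<^sub>R u s x))
    (\<lambda>_. 0) (at_right 0)"
proof (rule uniform_limit_compact_equicontinuous)
  let ?f = "\<lambda>r s. L2_norm (\<lambda>x. (convolve q (scaled \<psi> r) x - q x) *\<^sub>R u s x)"
  have uL2: "u s \<in> L2" if "s \<in> {0..T}" for s using u that by (simp add: C_into_def)
  then show "((\<lambda>r. ?f r s) \<longlongrightarrow> 0) (at_right 0)" if "s \<in> {0..T}" for s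
    using that by (intro mollify_Linf_scaleR_tendsto \<psi> q)
  fix s e :: real assume s: "s \<in> {0..T}" and "0 < e"
  define N where "N s' = L2_norm (\<lambda>x. u s' x - u s x)" for s'
  have "((\<lambda>s'. 2 * Linf_norm q * N s') \<longlongrightarrow> 0) (at s within {0..T})"
    using u s by (intro tendsto_mult_right_zero) (simp add: C_into_def N_def)
  from order_tendstoD(2)[OF this \<open>0 < e\<close>] obtain d where d: "0 < d"
    "\<And>s'. s' \<in> {0..T} \<Longrightarrow> s' \<noteq> s \<Longrightarrow> dist s' s < d \<Longrightarrow> 2 * Linf_norm q * N s' < e"
    by (auto simp: eventually_at)
  have "\<forall>\<^sub>F r in at_right 0. \<forall>s'\<in>{0..T}. dist s s' < d \<longrightarrow> dist (?f r s) (?f r s') < e"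
    using eventually_at_right_less
  proof (eventually_elim, intro ballI impI)
    fix r s' :: real assume "0 < r" "s' \<in> {0..T}" "dist s s' < d"
    show "dist (?f r s) (?f r s') < e"
    proof (cases "s' = s")
      case False
      have "dist (?f r s) (?f r s') \<le> 2 * Linf_norm q * N s'"
        using mollify_Linf_scaleR_lipschitz[OF mollifier_scaled[OF \<psi> \<open>0 < r\<close>] q
            uL2[OF s] uL2[OF \<open>s' \<in> {0..T}\<close>]]
        by (simp add: N_def dist_real_def L2_norm_minus_commute[of "u s"])
      also have "\<dots> < e" using d(2) False \<open>s' \<in> {0..T}\<close> \<open>dist s s' < d\<close> by (simp add: dist_commute)
      finally show ?thesis .
    qed (use \<open>0 < e\<close> in simp)
  qed
  with d(1) show "\<exists>d>0. \<forall>\<^sub>F r in at_right 0. \<forall>s'\<in>{0..T}.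
      dist s s' < d \<longrightarrow> dist (?f r s) (?f r s') < e"
    by blast
qed (rule compact_Icc trivial_limit_at_right_real)+

lemma eventually_at_right_0_in_unit: "\<forall>\<^sub>F \<epsilon> :: real in at_right 0. \<epsilon> \<in> {0<..1}"
  using eventually_at_right_real[of 0 "1::real"] by (auto elim: eventually_mono)

lemma regularising_scale_filterlim:
  assumes "regularising_scale \<omega>"
  shows "filterlim \<omega> (at_right 0) (at_right 0)"
  unfolding filterlim_at
proof
  show "\<forall>\<^sub>F \<epsilon> in at_right 0. \<omega> \<epsilon> \<in> {0<..} \<and> \<omega> \<epsilon> \<noteq> 0"
    using eventually_at_right_0_in_unit
    by eventually_elim (use assms in \<open>force simp: regularising_scale_def\<close>)
qed (use assms in \<open>simp add: regularising_scale_def\<close>)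

lemma regularising_families_tendsto:
  assumes \<omega>: "regularising_scale \<omega>" and fam: "regularising_families \<omega> q u0 q\<epsilon> u0\<epsilon>"
    and q: "q \<in> Linf" and u0: "u0 \<in> L2" and u: "u \<in> C_into T L2 L2_norm"
  shows "((\<lambda>\<epsilon>. L2_norm (\<lambda>x. u0\<epsilon> \<epsilon> x - u0 x)) \<longlongrightarrow> 0) (at_right 0)"
    and "uniform_limit {0..T} (\<lambda>\<epsilon> s. L2_norm (\<lambda>x. (q\<epsilon> \<epsilon> x - q x) *\<^sub>R u s x)) (\<lambda>_. 0) (at_right 0)"
proof -
  obtain \<psi> where \<psi>: "friedrichs_mollifier \<psi>" and eq: "\<And>\<epsilon>. \<epsilon> \<in> {0<..1} \<Longrightarrow>
      q\<epsilon> \<epsilon> = convolve q (scaled \<psi> (\<omega> \<epsilon>)) \<and> u0\<epsilon> \<epsilon> = convolve u0 (scaled \<psi> (\<omega> \<epsilon>))"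
    using fam unfolding regularising_families_def by blast
  note lim = regularising_scale_filterlim[OF \<omega>]
  show "((\<lambda>\<epsilon>. L2_norm (\<lambda>x. u0\<epsilon> \<epsilon> x - u0 x)) \<longlongrightarrow> 0) (at_right 0)"
    using filterlim_compose[OF mollify_L2_tendsto[OF \<psi> u0] lim]
    by (rule Lim_transform_eventually)
      (use eventually_at_right_0_in_unit in eventually_elim, simp add: eq)
  show "uniform_limit {0..T} (\<lambda>\<epsilon> s. L2_norm (\<lambda>x. (q\<epsilon> \<epsilon> x - q x) *\<^sub>R u s x)) (\<lambda>_. 0) (at_right 0)"
  proof (rule filterlim_cong[THEN iffD1, OF refl refl _ filterlim_compose[OF
        mollify_Linf_scaleR_uniform_limit[OF \<psi> q u] lim]])
    show "\<forall>\<^sub>F \<epsilon> in at_right 0.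
        (\<lambda>s. L2_norm (\<lambda>x. (convolve q (scaled \<psi> (\<omega> \<epsilon>)) x - q x) *\<^sub>R u s x)) =
        (\<lambda>s. L2_norm (\<lambda>x. (q\<epsilon> \<epsilon> x - q x) *\<^sub>R u s x))"
      using eventually_at_right_0_in_unit by eventually_elim (simp add: eq)
  qed
qed

theorem theorem2p8:
  fixes T :: real
    and \<omega> :: "real \<Rightarrow> real"
    and q :: "'a::euclidean_space \<Rightarrow> real"
    and u0 :: "'a \<Rightarrow> complex"
    and u :: "real \<Rightarrow> 'a \<Rightarrow> complex"
    and q\<epsilon> :: "real \<Rightarrow> 'a \<Rightarrow> real"
    and u0\<epsilon> :: "real \<Rightarrow> 'a \<Rightarrow> complex"
    and u\<epsilon> :: "real \<Rightarrow> real \<Rightarrow> 'a \<Rightarrow> complex"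
  assumes "T > 0"
    and "u0 \<in> H1"
    and "q \<in> Linf"
    and "AE x in lebesgue. q x \<ge> 0"
    and "classical_solution T q u0 u"
    and "regularising_scale \<omega>"
    and "very_weak_solution T \<omega> q u0 q\<epsilon> u0\<epsilon> u\<epsilon>"
  shows "\<forall>t\<in>{0..T}. ((\<lambda>\<epsilon>. L2_norm (\<lambda>x. u\<epsilon> \<epsilon> t x - u t x)) \<longlongrightarrow> 0) (at_right 0)"
proof
  fix t assume t: "t \<in> {0..T}"
  have fam: "regularising_families \<omega> q u0 q\<epsilon> u0\<epsilon>"
    using assms(7) by (simp add: very_weak_solution_def)
  then obtain \<psi> :: "'a \<Rightarrow> real" where \<psi>: "friedrichs_mollifier \<psi>"
    by (auto simp: regularising_families_def)
  have "u \<in> C_into T L2 L2_norm"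
    using assms(5) by (auto simp: classical_solution_def has_C1_L2_deriv_def)
  note data = regularising_families_tendsto[OF assms(6) fam assms(3) H1_L2[OF assms(2)] this]
  have "\<forall>\<^sub>F \<epsilon> in at_right 0. classical_solution T (q\<epsilon> \<epsilon>) (u0\<epsilon> \<epsilon>) (u\<epsilon> \<epsilon>) \<and> q\<epsilon> \<epsilon> \<in> Linf \<and>
      (AE x in lebesgue. 0 \<le> q\<epsilon> \<epsilon> x)"
    using eventually_at_right_0_in_unit
    by eventually_elim (use assms(7) in \<open>simp add: very_weak_solution_def moderate_def\<close>)
  from classical_solution_tendsto[OF \<psi> assms(5) assms(3) this data t]
  show "((\<lambda>\<epsilon>. L2_norm (\<lambda>x. u\<epsilon> \<epsilon> t x - u t x)) \<longlongrightarrow> 0) (at_right 0)" .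
qed

end
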